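(* For every real $\varepsilon$ with $0<\varepsilon<1/6$ there exists $q_0$ such that for all integers $q\geq q_0$ and all integers $p\geq 1$ with $p\leq\left(1/6-\varepsilon\right)q$, \[ r\left(B_{p},B_{q}\right)=2q+3. \]
   Context: For an integer $m\ge 1$, the book $B_m$ is the graph consisting of $m$ triangles sharing a common edge (i.e. $K_2$ joined to $m$ independent vertices). The Ramsey number $r(B_p,B_q)$ is the least integer $N$ such that for every graph $G$ on $N$ vertices, either $G$ contains $B_p$ as a subgraph or the complement $\overline{G}$ contains $B_q$ as a subgraph. *)

theory Defs
  imports Complex_Main "HOL-Library.Ramsey"
begin

type_synonym 'a graph = "'a set \<times> 'a set set"

abbreviation verts :: "'a graph \<Rightarrow> 'a set" where "verts \<equiv> fst"
abbreviation edges :: "'a graph \<Rightarrow> 'a set set" where "edges \<equiv> snd"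

definition simple_graph :: "'a graph \<Rightarrow> bool" where
  "simple_graph G \<longleftrightarrow> finite (verts G) \<and> edges G \<subseteq> [verts G]\<^bsup>2\<^esup>"

definition complement :: "'a graph \<Rightarrow> 'a graph" where
  "complement G = (verts G, [verts G]\<^bsup>2\<^esup> - edges G)"

(* Not necessarily induced, and up to isomorphism: G has a subgraph isomorphic to H. *)
definition contains_subgraph :: "'a graph \<Rightarrow> 'b graph \<Rightarrow> bool" where
  "contains_subgraph G H \<longleftrightarrow>
     (\<exists>f. inj_on f (verts H) \<and> f ` verts H \<subseteq> verts G \<and> (\<forall>e\<in>edges H. f ` e \<in> edges G))"

(* The common edge is {0, 1}; the third vertices of the m triangles are 2, ..., m + 1. *)
definition book :: "nat \<Rightarrow> nat graph" where
  "book m = ({..<m + 2}, insert {0, 1} {{i, j} | i j. i \<in> {0, 1} \<and> j \<in> {2..<m + 2}})"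

lemma simple_graph_book: "simple_graph (book m)"
  by (auto simp: simple_graph_def book_def)

(* Every finite graph is isomorphic to one whose vertices are natural numbers,
   so it suffices to let G range over graphs of type nat. *)
definition ramsey_number :: "'a graph \<Rightarrow> 'b graph \<Rightarrow> nat" where
  "ramsey_number H1 H2 =
     (LEAST N. \<forall>G :: nat graph. simple_graph G \<and> card (verts G) = N \<longrightarrow>
        contains_subgraph G H1 \<or> contains_subgraph (complement G) H2)"

end

theory Submission
  imports Defs
begin

text \<open>
  Colour the edges of \<open>G\<close> red and those of its complement blue, and suppose that on \<open>n = 2q + 3\<close>
  vertices there is neither a red \<open>B\<^sub>p\<close> nor a blue \<open>B\<^sub>q\<close>. Red edges then have red codegree less than
  \<open>p \<le> (1/12 - \<epsilon>/2) n\<close>, and blue pairs have fewer than \<open>q < n/2\<close> common blue neighbours.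

  By weak regularity and Ramsey's theorem almost all vertices split into monochromatic cliques
  (clusters) of a large constant size \<open>m\<close>, each consisting of twins: vertices whose codegree functions
  nearly agree in \<open>L\<^sup>1\<close>. So for most pairs of clusters a single red edge between them bounds all codegrees
  between them by about \<open>n/12\<close>, and a single blue pair bounds all common blue neighbourhoods by about
  \<open>n/2\<close>. Write \<open>f\<^sub>X\<close> for the average of the red neighbourhood indicators over a cluster \<open>X\<close>. If three blue
  clusters are pairwise joined by red edges, \<open>\<Sum>(f\<^sub>X + f\<^sub>Y + f\<^sub>Z - 1)\<^sup>2 \<ge> 0\<close> contradicts \<open>p < n/12\<close>. Hence the
  supports of \<open>f\<^sub>Y\<close> and \<open>f\<^sub>Z\<close> are almost disjoint on the blue clusters whenever \<open>Y\<close> and \<open>Z\<close> are joined, while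
  \<open>\<Sum>(1 - f\<^sub>Y)\<^sup>2\<close> and \<open>\<Sum>(1 - f\<^sub>Z)\<^sup>2\<close> are at most about \<open>n/2\<close>. This first forces the red clusters to be
  negligible and then forces \<open>f\<^sub>Y\<close> and \<open>f\<^sub>Z\<close> to be nearly \<open>0/1\<close>-valued with nearly complementary supports,
  so \<open>G\<close> contains a nearly complete bipartite graph on almost all vertices. An exact count of the
  remaining vertices against the blue codegrees inside the two sides shows \<open>n \<le> 2q + 2\<close>.
\<close>

subsection \<open>Weak regularity\<close>

text \<open>Splitting \<open>V\<close> by the sign of the column sums turns the sum of absolute
  values into two rectangle sums, each at most \<open>c\<close> in absolute value.\<close>

lemma cut_norm_imp_l1_bound:
  fixes R :: "'a \<Rightarrow> 'a \<Rightarrow> real"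
  assumes "finite V" and P: "P \<subseteq> V"
    and cut: "\<And>S T. S \<subseteq> V \<Longrightarrow> T \<subseteq> V \<Longrightarrow> \<bar>\<Sum>x\<in>S. \<Sum>y\<in>T. R x y\<bar> \<le> c"
  shows "(\<Sum>y\<in>V. \<bar>\<Sum>z\<in>P. R z y\<bar>) \<le> 2 * c"
proof -
  let ?r = "\<lambda>y. \<Sum>z\<in>P. R z y"
  define T where "T = {y\<in>V. ?r y \<ge> 0}"
  have T: "T \<subseteq> V" "V - T \<subseteq> V" by (auto simp: T_def)
  have "(\<Sum>y\<in>V. \<bar>?r y\<bar>) = (\<Sum>y\<in>T. \<bar>?r y\<bar>) + (\<Sum>y\<in>V-T. \<bar>?r y\<bar>)"
    using assms(1) T by (metis add.commute sum.subset_diff)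
  also have "\<dots> = (\<Sum>y\<in>T. ?r y) + (\<Sum>y\<in>V-T. - ?r y)"
    by (intro arg_cong2[of _ _ _ _ "(+)"] sum.cong) (auto simp: T_def)
  also have "\<dots> = (\<Sum>z\<in>P. \<Sum>y\<in>T. R z y) - (\<Sum>z\<in>P. \<Sum>y\<in>V-T. R z y)"
    by (simp add: sum_negf sum.swap[of _ P])
  also have "\<dots> \<le> 2 * c"
    using cut[OF P T(1)] cut[OF P T(2)] by linarith
  finally show ?thesis .
qed

lemma cut_norm_imp_l1_diff_bound:
  fixes R :: "'a \<Rightarrow> 'a \<Rightarrow> real"
  assumes fin: "finite V" and PQ: "P \<subseteq> V" "Q \<subseteq> V"
    and cut: "\<And>S T. S \<subseteq> V \<Longrightarrow> T \<subseteq> V \<Longrightarrow> \<bar>\<Sum>x\<in>S. \<Sum>y\<in>T. R x y\<bar> \<le> c"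
  shows "(\<Sum>y\<in>V. \<bar>(\<Sum>z\<in>P. R z y) - (\<Sum>z\<in>Q. R z y)\<bar>) \<le> 4 * c"
proof -
  have "(\<Sum>y\<in>V. \<bar>(\<Sum>z\<in>P. R z y) - (\<Sum>z\<in>Q. R z y)\<bar>)
    \<le> (\<Sum>y\<in>V. \<bar>\<Sum>z\<in>P. R z y\<bar>) + (\<Sum>y\<in>V. \<bar>\<Sum>z\<in>Q. R z y\<bar>)"
    unfolding sum.distrib[symmetric] by (intro sum_mono) linarith
  also have "\<dots> \<le> 2 * c + 2 * c"
    using PQ cut by (intro add_mono cut_norm_imp_l1_bound[OF fin]) auto
  finally show ?thesis by simp
qed

text \<open>Greedy form of the weak regularity lemma: as long as some rectangle \<open>S \<times> T\<close> has large
  discrepancy, subtracting a multiple of its indicator lowers the energy of \<open>R\<close> by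
  \<open>\<delta>\<^sup>2 |V|\<^sup>2\<close>.\<close>

lemma weak_regularity:
  fixes R :: "'a \<Rightarrow> 'a \<Rightarrow> real" and \<delta> :: real
  assumes fin: "finite V" and "\<delta> > 0"
    and "(\<Sum>x\<in>V. \<Sum>y\<in>V. (R x y)\<^sup>2) \<le> real k * \<delta>\<^sup>2 * (real (card V))\<^sup>2"
  shows "\<exists>Ss. length Ss \<le> k \<and> (\<forall>S\<in>set Ss. S \<subseteq> V) \<and>
    (\<forall>P Q. P \<subseteq> V \<longrightarrow> Q \<subseteq> V \<longrightarrow>
      (\<Sum>y\<in>V. \<bar>(\<Sum>z\<in>P. R z y) - (\<Sum>z\<in>Q. R z y)\<bar>)
        \<le> 4 * \<delta> * (real (card V))\<^sup>2
          + \<delta> * real (card V) * (\<Sum>S\<leftarrow>Ss. \<bar>real (card (S \<inter> P)) - real (card (S \<inter> Q))\<bar>))"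
  using assms(3)
proof (induction k arbitrary: R)
  case 0
  have 1: "(\<Sum>x\<in>V. \<Sum>y\<in>V. (R x y)\<^sup>2) \<le> 0" using 0 by simp
  have "R x y = 0" if "x \<in> V" "y \<in> V" for x y
  proof -
    have "(R x y)\<^sup>2 \<le> (\<Sum>y\<in>V. (R x y)\<^sup>2)"
      using that fin by (intro member_le_sum) auto
    also have "\<dots> \<le> (\<Sum>x\<in>V. \<Sum>y\<in>V. (R x y)\<^sup>2)"
      using that fin by (intro member_le_sum[of x V "\<lambda>x. \<Sum>y\<in>V. (R x y)\<^sup>2"]) (auto intro: sum_nonneg)
    also note 1
    finally show ?thesis by simp
  qed
  then have "(\<Sum>x\<in>S. \<Sum>y\<in>T. R x y) = 0" if "S \<subseteq> V" "T \<subseteq> V" for S T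
    using that by (intro sum.neutral ballI) auto
  then have "(\<Sum>y\<in>V. \<bar>(\<Sum>z\<in>P. R z y) - (\<Sum>z\<in>Q. R z y)\<bar>) \<le> 4 * (\<delta> * (real (card V))\<^sup>2)"
    if "P \<subseteq> V" "Q \<subseteq> V" for P Q
    using that \<open>\<delta> > 0\<close> by (intro cut_norm_imp_l1_diff_bound[OF fin]) auto
  then show ?case by (intro exI[of _ "[]"]) (auto simp: mult.assoc)
  next
  case (Suc k)
  let ?n = "real (card V)"
  show ?case
  proof (cases "\<forall>S T. S \<subseteq> V \<longrightarrow> T \<subseteq> V \<longrightarrow> \<bar>\<Sum>x\<in>S. \<Sum>y\<in>T. R x y\<bar> \<le> \<delta> * ?n\<^sup>2")
    case True
    then have "(\<Sum>y\<in>V. \<bar>(\<Sum>z\<in>P. R z y) - (\<Sum>z\<in>Q. R z y)\<bar>) \<le> 4 * (\<delta> * ?n\<^sup>2)"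
      if "P \<subseteq> V" "Q \<subseteq> V" for P Q
      using that by (intro cut_norm_imp_l1_diff_bound[OF fin]) auto
    then show ?thesis by (intro exI[of _ "[]"]) (auto simp: mult.assoc)
  next
    case False
    then obtain S T where ST: "S \<subseteq> V" "T \<subseteq> V"
      and big: "\<bar>\<Sum>x\<in>S. \<Sum>y\<in>T. R x y\<bar> > \<delta> * ?n\<^sup>2"
      unfolding not_all not_imp not_le by blast
    \<comment> \<open>The greedy step subtracts \<delta> with the sign of the discrepancy. The
      energy changes by -2 \<delta> |sum| + \<delta>^2 |S| |T|, which is below -\<delta>^2
      |V|^2.\<close>
    define s :: real where "s = sgn (\<Sum>x\<in>S. \<Sum>y\<in>T. R x y)"
    have nz: "(\<Sum>x\<in>S. \<Sum>y\<in>T. R x y) \<noteq> 0" using big \<open>\<delta> > 0\<close> by (auto simp: mult_less_0_iff)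
    have s2: "s\<^sup>2 = 1" "\<bar>s\<bar> = 1" using nz by (auto simp: s_def sgn_if)
    have sR: "s * (\<Sum>x\<in>S. \<Sum>y\<in>T. R x y) = \<bar>\<Sum>x\<in>S. \<Sum>y\<in>T. R x y\<bar>"
      by (simp add: s_def abs_sgn mult.commute)
    define c where "c = s * \<delta>"
    define I where "I x y = (of_bool (x \<in> S) * of_bool (y \<in> T) :: real)" for x y
    define R' where "R' x y = R x y - c * I x y" for x y
    have sub: "(\<Sum>x\<in>V. \<Sum>y\<in>V. h x y * I x y) = (\<Sum>x\<in>S. \<Sum>y\<in>T. h x y)" for h :: "'a \<Rightarrow> 'a \<Rightarrow> real"
    proof -
      have "(\<Sum>x\<in>V. \<Sum>y\<in>V. h x y * I x y) = (\<Sum>x\<in>V. of_bool (x\<in>S) * (\<Sum>y\<in>V. h x y * of_bool (y \<in> T)))"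
        by (simp add: I_def sum_distrib_left mult_ac)
      also have "\<dots> = (\<Sum>x\<in>V. of_bool (x\<in>S) * (\<Sum>y\<in>T. h x y))"
        using fin ST by (simp add: of_bool_def if_distrib[of "(*) _"] sum.If_cases Int_absorb1 cong: if_cong)
      also have "\<dots> = (\<Sum>x\<in>S. \<Sum>y\<in>T. h x y)"
        using fin ST by (intro sum.mono_neutral_cong_right) auto
      finally show ?thesis .
    qed
    have "(\<Sum>x\<in>V. \<Sum>y\<in>V. (R' x y)\<^sup>2)
        = (\<Sum>x\<in>V. \<Sum>y\<in>V. (R x y)\<^sup>2 - 2 * c * (R x y * I x y) + c\<^sup>2 * (1 * I x y))"
      by (intro sum.cong) (auto simp: R'_def I_def power2_eq_square algebra_simps)
    also have "\<dots> = (\<Sum>x\<in>V. \<Sum>y\<in>V. (R x y)\<^sup>2) - 2 * c * (\<Sum>x\<in>S. \<Sum>y\<in>T. R x y)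
          + c\<^sup>2 * (\<Sum>x\<in>S. \<Sum>y\<in>T. 1)"
      unfolding sub[symmetric] by (simp add: sum.distrib sum_subtractf sum_distrib_left)
    also have "\<dots> = (\<Sum>x\<in>V. \<Sum>y\<in>V. (R x y)\<^sup>2) - 2 * \<delta> * \<bar>\<Sum>x\<in>S. \<Sum>y\<in>T. R x y\<bar>
          + \<delta>\<^sup>2 * (real (card S) * real (card T))"
      using s2 sR by (simp add: c_def power_mult_distrib)
    also have "\<dots> \<le> real (Suc k) * \<delta>\<^sup>2 * ?n\<^sup>2 - 2 * \<delta> * (\<delta> * ?n\<^sup>2) + \<delta>\<^sup>2 * (?n * ?n)"
    proof -
      have "card S \<le> card V" "card T \<le> card V" using ST fin by (auto intro: card_mono)
      then have "\<delta>\<^sup>2 * (real (card S) * real (card T)) \<le> \<delta>\<^sup>2 * (?n * ?n)"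
        by (intro mult_left_mono mult_mono) auto
      moreover have "2 * \<delta> * \<bar>\<Sum>x\<in>S. \<Sum>y\<in>T. R x y\<bar> \<ge> 2 * \<delta> * (\<delta> * ?n\<^sup>2)"
        using big \<open>\<delta> > 0\<close> by (intro mult_left_mono) auto
      ultimately show ?thesis using Suc.prems by linarith
    qed
    also have "\<dots> = real k * \<delta>\<^sup>2 * ?n\<^sup>2" by (simp add: power2_eq_square algebra_simps)
    finally obtain Ss where Ss: "length Ss \<le> k" "\<forall>S\<in>set Ss. S \<subseteq> V"
      and bd: "\<And>P Q. P \<subseteq> V \<Longrightarrow> Q \<subseteq> V \<Longrightarrow>
    (\<Sum>y\<in>V. \<bar>(\<Sum>z\<in>P. R' z y) - (\<Sum>z\<in>Q. R' z y)\<bar>) \<le> 4 * \<delta> * ?n\<^sup>2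
        + \<delta> * ?n * (\<Sum>S\<leftarrow>Ss. \<bar>real (card (S \<inter> P)) - real (card (S \<inter> Q))\<bar>)"
      using Suc.IH[of R'] by blast
    show ?thesis
    proof (intro exI[of _ "S # Ss"] conjI allI impI)
      fix P Q assume PQ: "P \<subseteq> V" "Q \<subseteq> V"
      \<comment> \<open>Putting the rectangle back changes the column sum over \<open>P\<close> only
        for \<open>y\<close> in \<open>T\<close>, by \<open>c\<close> times
        \<open>card (S \<inter> P)\<close>. Comparing \<open>P\<close> with \<open>Q\<close> yields
        the new summand of the list bound.\<close>
      have IP: "(\<Sum>z\<in>P. R z y) = (\<Sum>z\<in>P. R' z y) + c * of_bool (y \<in> T) * real (card (S \<inter> P))"
        if "P \<subseteq> V" for P y
      proof -
        have "finite P" using that fin finite_subset by auto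
        then show ?thesis
          by (simp add: R'_def I_def sum_subtractf sum_distrib_left[symmetric] sum_distrib_right[symmetric]
            of_bool_def sum.If_cases Int_commute mult_ac)
      qed
      let ?D = "\<bar>real (card (S \<inter> P)) - real (card (S \<inter> Q))\<bar>"
      have "(\<Sum>y\<in>V. \<bar>(\<Sum>z\<in>P. R z y) - (\<Sum>z\<in>Q. R z y)\<bar>)
        \<le> (\<Sum>y\<in>V. \<bar>(\<Sum>z\<in>P. R' z y) - (\<Sum>z\<in>Q. R' z y)\<bar> + \<delta> * ?D)"
      proof (intro sum_mono)
        fix y
        have "\<bar>c * of_bool (y \<in> T) * (real (card (S \<inter> P)) - real (card (S \<inter> Q)))\<bar> \<le> \<delta> * ?D"
          using s2 \<open>\<delta> > 0\<close> by (auto simp: c_def abs_mult)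
        then show "\<bar>(\<Sum>z\<in>P. R z y) - (\<Sum>z\<in>Q. R z y)\<bar>
            \<le> \<bar>(\<Sum>z\<in>P. R' z y) - (\<Sum>z\<in>Q. R' z y)\<bar> + \<delta> * ?D"
          unfolding IP[OF PQ(1)] IP[OF PQ(2)] right_diff_distrib by linarith
      qed
      also have "\<dots> = (\<Sum>y\<in>V. \<bar>(\<Sum>z\<in>P. R' z y) - (\<Sum>z\<in>Q. R' z y)\<bar>) + \<delta> * ?n * ?D"
        by (simp add: sum.distrib)
      also have "\<dots> \<le> 4 * \<delta> * ?n\<^sup>2
        + \<delta> * ?n * (\<Sum>S\<leftarrow>S # Ss. \<bar>real (card (S \<inter> P)) - real (card (S \<inter> Q))\<bar>)"
        using bd[OF PQ] by (simp add: algebra_simps)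
      finally show "(\<Sum>y\<in>V. \<bar>(\<Sum>z\<in>P. R z y) - (\<Sum>z\<in>Q. R z y)\<bar>) \<le> 4 * \<delta> * ?n\<^sup>2
        + \<delta> * ?n * (\<Sum>S\<leftarrow>S # Ss. \<bar>real (card (S \<inter> P)) - real (card (S \<inter> Q))\<bar>)" .
    qed (use Ss ST in auto)
  qed
qed

subsection \<open>Twins\<close>

locale finite_graph =
  fixes V :: "'a set" and E :: "'a \<Rightarrow> 'a \<Rightarrow> bool"
  assumes fin: "finite V" and sym: "E x y \<Longrightarrow> E y x" and irrefl: "\<not> E x x"
begin

definition ind :: "'a \<Rightarrow> 'a \<Rightarrow> real" where "ind x y = of_bool (E x y)"

definition deg :: "'a \<Rightarrow> real" where "deg x = (\<Sum>v\<in>V. ind x v)"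

definition cod :: "'a \<Rightarrow> 'a \<Rightarrow> real" where "cod x y = (\<Sum>v\<in>V. ind x v * ind y v)"

definition ccod :: "'a \<Rightarrow> 'a \<Rightarrow> real" where
  "ccod x y = (\<Sum>v\<in>V. (1 - ind x v) * (1 - ind y v))"

text \<open>Twins may have quite different neighbourhoods: only degrees and codegree functions are
  compared, and these are determined up to small error by the degrees into boundedly many
  sets.\<close>

definition twins :: "real \<Rightarrow> 'a \<Rightarrow> 'a \<Rightarrow> bool" where
  "twins \<kappa> x x' \<longleftrightarrow> \<bar>deg x - deg x'\<bar> \<le> \<kappa> * card V \<and>
     (\<Sum>y\<in>V. \<bar>cod x y - cod x' y\<bar>) \<le> \<kappa> * (real (card V))\<^sup>2"

lemma ind_sym: "ind x y = ind y x"
  using sym by (auto simp: ind_def)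

lemma ind_bounds [simp]: "0 \<le> ind x y" "ind x y \<le> 1"
  by (auto simp: ind_def)

lemma cod_sym: "cod x y = cod y x"
  by (simp add: cod_def mult.commute)

lemma deg_eq_card: "deg x = card {v\<in>V. E x v}"
  using fin by (simp add: deg_def ind_def sum.If_cases of_bool_def Int_def)

lemma cod_eq_sum: "cod x y = (\<Sum>z | z \<in> V \<and> E x z. ind z y)"
proof -
  have "cod x y = (\<Sum>v\<in>V. if E x v then ind v y else 0)"
    unfolding cod_def by (intro sum.cong) (auto simp: ind_def sym)
  then show ?thesis using fin by (simp add: sum.If_cases Int_def)
qed

lemma cod_eq_card: "cod x y = card {v\<in>V. E x v \<and> E y v}"
proof -
  have "cod x y = (\<Sum>v\<in>V. if E x v \<and> E y v then 1 else 0)"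
    unfolding cod_def by (intro sum.cong) (auto simp: ind_def)
  then show ?thesis using fin by (simp add: sum.If_cases Int_def)
qed

lemma ccod_eq_card: "ccod x y = card {v\<in>V. \<not> E x v \<and> \<not> E y v}"
proof -
  have "ccod x y = (\<Sum>v\<in>V. if \<not> E x v \<and> \<not> E y v then 1 else 0)"
    unfolding ccod_def by (intro sum.cong) (auto simp: ind_def)
  then show ?thesis using fin by (simp add: sum.If_cases Int_def)
qed

lemma ccod_eq: "ccod x y = card V - deg x - deg y + cod x y"
  by (simp add: ccod_def deg_def cod_def algebra_simps sum.distrib sum_subtractf)

lemma cod_le: "cod x y \<le> card V" and ccod_le: "ccod x y \<le> card V"
  unfolding cod_eq_card ccod_eq_card using fin by (auto intro: card_mono)

end

text \<open>By weak regularity, the functions \<open>cod x\<close> are determined up to a small \<open>L\<^sup>1\<close> error by the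
  degrees of \<open>x\<close> into boundedly many sets.\<close>

lemma many_twins:
  fixes \<kappa> :: real
  assumes "\<kappa> > 0"
  shows "\<exists>M. \<forall>(V :: 'a set) E U. finite_graph V E \<and> U \<subseteq> V \<and> card U \<ge> M \<longrightarrow>
    (\<exists>W\<subseteq>U. card W = r \<and> (\<forall>x\<in>W. \<forall>y\<in>W. finite_graph.twins V E \<kappa> x y))"
proof -
  \<comment> \<open>The codegree error is \<open>4 * \<delta>\<close> from the remaining discrepancy
    plus \<delta> from the sets, in total \<kappa>. The number \<open>k\<close> of sets satisfies k
    \<delta>^2 \<ge> 1, as the adjacency indicator has energy at most |V|^2; rounding with step
    \<kappa>' \<le> 1/(k+1) costs at most |V| over all sets.\<close>
  define \<delta> where "\<delta> = \<kappa> / 5"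
  define k where "k = nat \<lceil>1 / \<delta>\<^sup>2\<rceil>"
  define \<kappa>' where "\<kappa>' = min \<kappa> (1 / (real k + 1))"
  define B where "B = nat \<lfloor>1 / \<kappa>'\<rfloor>"
  define C where "C = {xs. set xs \<subseteq> {..B} \<and> length xs \<le> k + 1}"
  have pos: "\<delta> > 0" "\<kappa>' > 0" using assms by (auto simp: \<delta>_def \<kappa>'_def)
  have k: "real k * \<delta>\<^sup>2 \<ge> 1"
  proof -
    have "1 / \<delta>\<^sup>2 \<le> real k" unfolding k_def by linarith
    then show ?thesis using pos by (simp add: field_simps)
  qed
  have kk: "real k * \<kappa>' \<le> 1"
  proof -
    have "real k * \<kappa>' \<le> real k * (1 / (real k + 1))" by (intro mult_left_mono) (auto simp: \<kappa>'_def)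
    also have "\<dots> \<le> 1" by simp
    finally show ?thesis .
  qed
  have C: "finite C" "C \<noteq> {}" unfolding C_def
    by (auto simp: finite_lists_length_le intro!: exI[of _ "[]"])
  show ?thesis
  proof (intro exI[of _ "r * card C + 1"] allI impI, elim conjE)
    fix V :: "'a set" and E U
    assume "finite_graph V E" and U: "U \<subseteq> V" "r * card C + 1 \<le> card U"
    interpret finite_graph V E by fact
    let ?n = "real (card V)"
    have finU: "finite U" using U fin finite_subset by auto
    have n: "?n > 0" using U fin by (auto simp: card_gt_0_iff)
    define nb where "nb x = {v\<in>V. E x v}" for x
    have "(\<Sum>x\<in>V. \<Sum>y\<in>V. (ind x y)\<^sup>2) \<le> (\<Sum>x\<in>V. \<Sum>y\<in>V. 1)"
      by (intro sum_mono) (auto simp: ind_def)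
    also have "\<dots> = 1 * ?n\<^sup>2" by (simp add: power2_eq_square)
    also have "\<dots> \<le> real k * \<delta>\<^sup>2 * ?n\<^sup>2" using k by (intro mult_right_mono) auto
    finally obtain Ss where Ss: "length Ss \<le> k" "\<forall>S\<in>set Ss. S \<subseteq> V" and bd: "\<And>P Q. P \<subseteq> V \<Longrightarrow> Q \<subseteq> V \<Longrightarrow>
      (\<Sum>y\<in>V. \<bar>(\<Sum>z\<in>P. ind z y) - (\<Sum>z\<in>Q. ind z y)\<bar>) \<le> 4 * \<delta> * ?n\<^sup>2
          + \<delta> * ?n * (\<Sum>S\<leftarrow>Ss. \<bar>real (card (S \<inter> P)) - real (card (S \<inter> Q))\<bar>)"
      using weak_regularity[OF fin pos(1), of ind k] by blast
    \<comment> \<open>A vertex is coloured by its rounded degrees into \<open>V\<close> and the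
      regularity sets; the entry for \<open>V\<close> controls the degree itself. The colour set
      \<open>C\<close> does not depend on the graph.\<close>
    define col where "col x = map (\<lambda>S. nat \<lfloor>card (S \<inter> nb x) / (\<kappa>' * ?n)\<rfloor>) (V # Ss)" for x
    have "col \<in> U \<rightarrow> C"
    proof
      fix x
      have "nat \<lfloor>card (S \<inter> nb x) / (\<kappa>' * ?n)\<rfloor> \<le> B" for S
      proof -
        have "card (S \<inter> nb x) \<le> card V" using fin by (intro card_mono) (auto simp: nb_def)
        then have "card (S \<inter> nb x) / (\<kappa>' * ?n) \<le> ?n / (\<kappa>' * ?n)"
          using pos n by (intro divide_right_mono) auto
        also have "\<dots> = 1 / \<kappa>'" using n by simp
        finally show ?thesis unfolding B_def by (intro nat_mono floor_mono)
      qed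
      then show "col x \<in> C" using Ss by (auto simp: col_def C_def)
    qed
    then obtain c where c: "card (col -` {c} \<inter> U) * card C \<ge> card U"
      using pigeonhole_card[OF _ finU C] by blast
    have "r \<le> card (col -` {c} \<inter> U)"
    proof (rule ccontr)
      assume "\<not> ?thesis"
      then have "card (col -` {c} \<inter> U) * card C \<le> r * card C" by (intro mult_right_mono) auto
      then show False using c U by linarith
    qed
    then obtain W where W: "W \<subseteq> col -` {c} \<inter> U" "card W = r"
      using obtain_subset_with_card_n by metis
    have "twins \<kappa> x x'" if "x \<in> W" "x' \<in> W" for x x'
    proof -
      have "col x = col x'" using that W by auto
      then have eq: "nat \<lfloor>card (S \<inter> nb x) / (\<kappa>' * ?n)\<rfloor> = nat \<lfloor>card (S \<inter> nb x') / (\<kappa>' * ?n)\<rfloor>"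
        if "S \<in> set (V # Ss)" for S
        using that unfolding col_def map_eq_conv by blast
      have close: "\<bar>real (card (S \<inter> nb x)) - real (card (S \<inter> nb x'))\<bar> \<le> \<kappa>' * ?n"
        if "S \<in> set (V # Ss)" for S
      proof -
        let ?a = "card (S \<inter> nb x) / (\<kappa>' * ?n)" and ?b = "card (S \<inter> nb x') / (\<kappa>' * ?n)"
        have "?a \<ge> 0" "?b \<ge> 0" using pos by auto
        then have "\<lfloor>?a\<rfloor> = \<lfloor>?b\<rfloor>" using eq[OF that] by (simp add: eq_nat_nat_iff)
        then have "\<bar>?a - ?b\<bar> \<le> 1" by linarith
        then have "\<bar>?a - ?b\<bar> * (\<kappa>' * ?n) \<le> 1 * (\<kappa>' * ?n)"
          using pos by (intro mult_right_mono) auto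
        moreover have "\<bar>?a - ?b\<bar> * (\<kappa>' * ?n) = \<bar>(?a - ?b) * (\<kappa>' * ?n)\<bar>"
          using pos by (simp add: abs_mult)
        moreover have "(?a - ?b) * (\<kappa>' * ?n) = real (card (S \<inter> nb x)) - real (card (S \<inter> nb x'))"
          using pos n by (simp add: field_simps)
        ultimately show ?thesis by simp
      qed
      have nbV: "nb y \<subseteq> V" "V \<inter> nb y = nb y" for y by (auto simp: nb_def)
      have "\<bar>deg x - deg x'\<bar> \<le> \<kappa>' * ?n"
        using close[of V] nbV by (simp add: deg_eq_card nb_def)
      also have "\<dots> \<le> \<kappa> * ?n" by (intro mult_right_mono) (auto simp: \<kappa>'_def)
      finally have d: "\<bar>deg x - deg x'\<bar> \<le> \<kappa> * ?n" .
      have "(\<Sum>S\<leftarrow>Ss. \<bar>real (card (S \<inter> nb x)) - real (card (S \<inter> nb x'))\<bar>) \<le> (\<Sum>S\<leftarrow>Ss. \<kappa>' * ?n)"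
        using close by (intro sum_list_mono) auto
      also have "\<dots> = real (length Ss) * (\<kappa>' * ?n)" by (simp add: sum_list_triv)
      also have "\<dots> \<le> real k * (\<kappa>' * ?n)" using Ss pos by (intro mult_right_mono) auto
      also have "\<dots> = real k * \<kappa>' * ?n" by simp
      also have "\<dots> \<le> 1 * ?n" using kk by (intro mult_right_mono) auto
      finally have s: "(\<Sum>S\<leftarrow>Ss. \<bar>real (card (S \<inter> nb x)) - real (card (S \<inter> nb x'))\<bar>) \<le> ?n" by simp
      have "(\<Sum>y\<in>V. \<bar>cod x y - cod x' y\<bar>) = (\<Sum>y\<in>V. \<bar>(\<Sum>z\<in>nb x. ind z y) - (\<Sum>z\<in>nb x'. ind z y)\<bar>)"
        by (simp add: cod_eq_sum nb_def)
      also have "\<dots> \<le> 4 * \<delta> * ?n\<^sup>2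
          + \<delta> * ?n * (\<Sum>S\<leftarrow>Ss. \<bar>real (card (S \<inter> nb x)) - real (card (S \<inter> nb x'))\<bar>)"
        by (rule bd[OF nbV(1) nbV(1)])
      also have "\<dots> \<le> 4 * \<delta> * ?n\<^sup>2 + \<delta> * ?n * ?n"
        using s pos by (intro add_left_mono mult_left_mono) auto
      also have "\<dots> = \<kappa> * ?n\<^sup>2" by (simp add: \<delta>_def power2_eq_square)
      finally show ?thesis using d by (simp add: twins_def)
    qed
    then show "\<exists>W\<subseteq>U. card W = r \<and> (\<forall>x\<in>W. \<forall>y\<in>W. twins \<kappa> x y)"
      using W by (intro exI[of _ W]) auto
  qed
qed

subsection \<open>Partition into homogeneous clusters of twins\<close>

lemma markov_card:
  fixes f :: "'a \<Rightarrow> real"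
  assumes "finite A" and "\<And>x. x \<in> A \<Longrightarrow> f x \<ge> 0"
  shows "c * card {x\<in>A. f x > c} \<le> sum f A"
proof -
  have "c * card {x\<in>A. f x > c} = (\<Sum>x | x \<in> A \<and> f x > c. c)" by simp
  also have "\<dots> \<le> (\<Sum>x | x \<in> A \<and> f x > c. f x)" by (intro sum_mono) auto
  also have "\<dots> \<le> sum f A" using assms by (intro sum_mono2) auto
  finally show ?thesis .
qed

lemma card_disjoint_meeting_le:
  assumes "pairwise disjnt F" and "finite S"
  shows "card {Y\<in>F. Y \<inter> S \<noteq> {}} \<le> card S"
proof -
  have "\<exists>g. \<forall>Y\<in>{Y\<in>F. Y \<inter> S \<noteq> {}}. g Y \<in> Y \<inter> S"
    by (intro bchoice) auto
  then obtain g where g: "\<And>Y. Y \<in> F \<Longrightarrow> Y \<inter> S \<noteq> {} \<Longrightarrow> g Y \<in> Y \<inter> S" by auto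
  have "inj_on g {Y\<in>F. Y \<inter> S \<noteq> {}}"
  proof (rule inj_onI)
    fix X Y assume *: "X \<in> {Y\<in>F. Y \<inter> S \<noteq> {}}" "Y \<in> {Y\<in>F. Y \<inter> S \<noteq> {}}" "g X = g Y"
    then have "g X \<in> X \<inter> Y" using g[of X] g[of Y] by auto
    then show "X = Y" using assms(1) * unfolding pairwise_def disjnt_def by blast
  qed
  then show ?thesis
    using assms(2) g by (intro card_inj_on_le[of g]) auto
qed

lemma sum_card_swap:
  assumes "finite A" "finite B"
  shows "(\<Sum>x\<in>A. card {y\<in>B. R x y}) = (\<Sum>y\<in>B. card {x\<in>A. R x y})"
proof -
  have "(\<Sum>x\<in>A. card {y\<in>B. R x y}) = (\<Sum>x\<in>A. \<Sum>y\<in>B. of_bool (R x y))"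
    using assms by (simp add: of_bool_def sum.If_cases Int_def)
  also have "\<dots> = (\<Sum>y\<in>B. \<Sum>x\<in>A. of_bool (R x y))" by (rule sum.swap)
  also have "\<dots> = (\<Sum>y\<in>B. card {x\<in>A. R x y})"
    using assms by (simp add: of_bool_def sum.If_cases Int_def)
  finally show ?thesis .
qed

context finite_graph
begin

definition homogeneous :: "'a set \<Rightarrow> bool" where
  "homogeneous X \<longleftrightarrow> (\<forall>x\<in>X. \<forall>y\<in>X. x \<noteq> y \<longrightarrow> E x y) \<or> (\<forall>x\<in>X. \<forall>y\<in>X. \<not> E x y)"

text \<open>Under agreement one red edge, or one blue pair, between two clusters bounds the
  codegrees of all pairs between them.\<close>

definition agree :: "real \<Rightarrow> 'a set \<Rightarrow> 'a set \<Rightarrow> bool" where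
  "agree \<tau> X Y \<longleftrightarrow> (\<forall>x\<in>X. \<forall>x'\<in>X. \<forall>y\<in>Y. \<forall>y'\<in>Y.
     \<bar>cod x y - cod x' y'\<bar> \<le> \<tau> * card V \<and> \<bar>ccod x y - ccod x' y'\<bar> \<le> \<tau> * card V)"

definition unstable :: "real \<Rightarrow> 'a set \<Rightarrow> 'a set" where
  "unstable t X = {v\<in>V. \<exists>x\<in>X. \<exists>x'\<in>X. \<bar>cod x v - cod x' v\<bar> > t}"

text \<open>Markov's inequality for each of the m^2 ordered pairs of twins, followed by the union
  bound.\<close>

lemma card_unstable:
  assumes X: "X \<subseteq> V" "card X = m" and tw: "\<And>x x'. x \<in> X \<Longrightarrow> x' \<in> X \<Longrightarrow> twins \<kappa> x x'"
    and t: "t > 0"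
  shows "t * card (unstable t X) \<le> (real m)\<^sup>2 * \<kappa> * (real (card V))\<^sup>2"
proof -
  let ?U = "\<lambda>x x'. {v\<in>V. \<bar>cod x v - cod x' v\<bar> > t}"
  have finX: "finite X" using X fin finite_subset by auto
  have "unstable t X = (\<Union>x\<in>X. \<Union>x'\<in>X. ?U x x')" by (auto simp: unstable_def)
  then have "card (unstable t X) \<le> (\<Sum>x\<in>X. card (\<Union>x'\<in>X. ?U x x'))"
    using finX by (simp add: card_UN_le)
  also have "\<dots> \<le> (\<Sum>x\<in>X. \<Sum>x'\<in>X. card (?U x x'))"
    using finX by (intro sum_mono card_UN_le)
  finally have "real (card (unstable t X)) \<le> (\<Sum>x\<in>X. \<Sum>x'\<in>X. real (card (?U x x')))"
    by (metis (mono_tags, lifting) of_nat_mono of_nat_sum sum.cong)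
  then have "t * card (unstable t X) \<le> t * (\<Sum>x\<in>X. \<Sum>x'\<in>X. real (card (?U x x')))"
    using t by (intro mult_left_mono) auto
  also have "\<dots> = (\<Sum>x\<in>X. \<Sum>x'\<in>X. t * card (?U x x'))"
    by (simp add: sum_distrib_left)
  also have "\<dots> \<le> (\<Sum>x\<in>X. \<Sum>x'\<in>X. \<kappa> * (real (card V))\<^sup>2)"
  proof (intro sum_mono)
    fix x x' assume "x \<in> X" "x' \<in> X"
    then have "(\<Sum>y\<in>V. \<bar>cod x y - cod x' y\<bar>) \<le> \<kappa> * (real (card V))\<^sup>2"
      using tw by (auto simp: twins_def)
    then show "t * card (?U x x') \<le> \<kappa> * (real (card V))\<^sup>2"
      using markov_card[OF fin, of "\<lambda>v. \<bar>cod x v - cod x' v\<bar>" t] by simp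
  qed
  also have "\<dots> = (real m)\<^sup>2 * \<kappa> * (real (card V))\<^sup>2"
    using X by (simp add: power2_eq_square)
  finally show ?thesis .
qed

text \<open>Passing from (x, y) to (x', y) and then to (x', y') changes \<open>cod\<close> by at
  most \<tau>/4 of |V| each time. For \<open>ccod\<close> the two degree changes add at most
  \<open>2 * \<kappa> * card V\<close>, the other half of the allowed error.\<close>

lemma agree_if_stable:
  assumes "X \<subseteq> V" "Y \<subseteq> V" "\<And>x x'. x \<in> X \<Longrightarrow> x' \<in> X \<Longrightarrow> twins \<kappa> x x'"
    "\<And>x x'. x \<in> Y \<Longrightarrow> x' \<in> Y \<Longrightarrow> twins \<kappa> x x'"
    and "\<kappa> \<le> \<tau> / 4" and "\<tau> \<ge> 0"
    and stab: "Y \<inter> unstable (\<tau> * card V / 4) X = {}" "X \<inter> unstable (\<tau> * card V / 4) Y = {}"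
  shows "agree \<tau> X Y"
  unfolding agree_def
proof (intro ballI)
  fix x x' y y' assume *: "x \<in> X" "x' \<in> X" "y \<in> Y" "y' \<in> Y"
  let ?n = "real (card V)"
  have 1: "\<bar>cod x y - cod x' y\<bar> \<le> \<tau> * ?n / 4"
    using stab(1) * assms(2) unfolding unstable_def not_less[symmetric] by blast
  have "\<bar>cod y x' - cod y' x'\<bar> \<le> \<tau> * ?n / 4"
    using stab(2) * assms(1) unfolding unstable_def not_less[symmetric] by blast
  then have 2: "\<bar>cod x' y - cod x' y'\<bar> \<le> \<tau> * ?n / 4"
    by (simp add: cod_sym)
  have "\<kappa> * ?n \<le> \<tau> / 4 * ?n" using assms(5) by (intro mult_right_mono) auto
  moreover have "\<bar>deg x - deg x'\<bar> \<le> \<kappa> * ?n" "\<bar>deg y - deg y'\<bar> \<le> \<kappa> * ?n"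
    using * assms(3,4) by (auto simp: twins_def)
  moreover have "\<tau> * ?n \<ge> 0" using assms by simp
  ultimately show "\<bar>cod x y - cod x' y'\<bar> \<le> \<tau> * ?n \<and> \<bar>ccod x y - ccod x' y'\<bar> \<le> \<tau> * ?n"
    unfolding ccod_eq using 1 2 by linarith
qed

end

text \<open>\<open>many_twins\<close> supplies as many mutual twins as Ramsey's theorem needs for a
  clique or an independent set of size \<open>m\<close>.\<close>

lemma homogeneous_twins:
  fixes \<kappa> :: real
  assumes "\<kappa> > 0"
  shows "\<exists>M. \<forall>(V :: 'a set) E U. finite_graph V E \<and> U \<subseteq> V \<and> card U \<ge> M \<longrightarrow>
    (\<exists>X\<subseteq>U. card X = m \<and> finite_graph.homogeneous E X \<and>
      (\<forall>x\<in>X. \<forall>y\<in>X. finite_graph.twins V E \<kappa> x y))"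
proof -
  obtain r where r: "r \<ge> 1" "\<And>(V :: 'a set) (E :: 'a set set). finite V \<and> card V \<ge> r \<Longrightarrow>
    \<exists>R \<subseteq> V. card R = m \<and> clique R E \<or> card R = m \<and> indep R E"
    using ramsey2[of m m] by metis
  obtain M where M: "\<forall>(V :: 'a set) E U. finite_graph V E \<and> U \<subseteq> V \<and> card U \<ge> M \<longrightarrow>
    (\<exists>W\<subseteq>U. card W = r \<and> (\<forall>x\<in>W. \<forall>y\<in>W. finite_graph.twins V E \<kappa> x y))"
    using many_twins[OF assms, of r] ..
  show ?thesis
  proof (intro exI[of _ M] allI impI, elim conjE)
    fix V :: "'a set" and E U
    assume g: "finite_graph V E" and U: "U \<subseteq> V" "M \<le> card U"
    interpret finite_graph V E by fact
    obtain W where W: "W \<subseteq> U" "card W = r" "\<And>x y. x \<in> W \<Longrightarrow> y \<in> W \<Longrightarrow> twins \<kappa> x y"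
      using M g U by meson
    have "finite W" using W r(1) by (auto intro: card_ge_0_finite)
    then obtain X where X: "X \<subseteq> W" "card X = m"
      and mono: "clique X {{x, y} | x y. E x y} \<or> indep X {{x, y} | x y. E x y}"
      using r(2)[of W "{{x, y} | x y. E x y}"] W(2) by blast
    have *: "{x, y} \<in> {{x, y} | x y. E x y} \<longleftrightarrow> E x y" for x y
      using sym by (auto simp: doubleton_eq_iff)
    have "\<forall>x\<in>X. \<forall>y\<in>X. twins \<kappa> x y" "X \<subseteq> U"
      using X(1) W(1,3) by (blast, blast)
    moreover have "homogeneous X"
      using mono irrefl unfolding homogeneous_def clique_def indep_def * by metis
    ultimately show "\<exists>X\<subseteq>U. card X = m \<and> homogeneous X \<and> (\<forall>x\<in>X. \<forall>y\<in>X. twins \<kappa> x y)"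
      using X(2) by blast
  qed
qed

text \<open>A maximal disjoint family of homogeneous twin clusters leaves fewer than
  \<open>M\<close> vertices uncovered. Disagreement is rare on average, and clusters that disagree
  with too many others are dropped.\<close>

lemma cluster_family:
  fixes \<tau> :: real
  assumes "0 < \<tau>" "\<tau> \<le> 1" and m: "m \<ge> 1"
  shows "\<exists>n\<^sub>0. \<forall>(V :: 'a set) E. finite_graph V E \<and> card V \<ge> n\<^sub>0 \<longrightarrow>
    (\<exists>F. (\<forall>X\<in>F. X \<subseteq> V \<and> card X = m \<and> finite_graph.homogeneous E X) \<and> pairwise disjnt F \<and>
      card (V - \<Union>F) \<le> \<tau> * card V \<and>
      (\<forall>X\<in>F. card (\<Union>{Y\<in>F. \<not> finite_graph.agree V E \<tau> X Y}) \<le> \<tau> * card V))"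
proof -
  \<comment> \<open>Chosen so that the dropped clusters cover at most \<open>\<tau> * ?n / 2\<close>
    vertices; the lower bound on |V| below does the same for the uncovered remainder.\<close>
  define \<kappa> where "\<kappa> = \<tau> ^ 3 / (16 * real m ^ 3)"
  have \<kappa>: "\<kappa> > 0" using assms by (simp add: \<kappa>_def)
  have "\<tau> ^ 3 / (16 * real m ^ 3) \<le> \<tau> / 4"
  proof -
    have "\<tau> ^ 3 / (16 * real m ^ 3) \<le> \<tau> ^ 3 / 4"
    proof (intro divide_left_mono)
      have "real m ^ 3 \<ge> 1" using m by (intro one_le_power) auto
      then show "4 \<le> 16 * real m ^ 3" by simp
    qed (use assms in auto)
    also have "\<dots> \<le> \<tau> / 4" using power_decreasing[of 1 3 \<tau>] assms by simp
    finally show ?thesis .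
  qed
  then have \<kappa>4: "\<kappa> \<le> \<tau> / 4" by (simp add: \<kappa>_def)
  obtain M where M: "\<forall>(V :: 'a set) E U. finite_graph V E \<and> U \<subseteq> V \<and> card U \<ge> M \<longrightarrow>
    (\<exists>X\<subseteq>U. card X = m \<and> finite_graph.homogeneous E X \<and>
      (\<forall>x\<in>X. \<forall>y\<in>X. finite_graph.twins V E \<kappa> x y))"
    using homogeneous_twins[OF \<kappa>, of m] ..
  show ?thesis
  proof (intro exI[of _ "nat \<lceil>2 * real M / \<tau>\<rceil> + 1"] allI impI, elim conjE)
    fix V :: "'a set" and E
    assume g: "finite_graph V E" and n0: "nat \<lceil>2 * real M / \<tau>\<rceil> + 1 \<le> card V"
    interpret finite_graph V E by fact
    let ?n = "real (card V)"
    have n: "?n > 0" using n0 by linarith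
    have "2 * real M / \<tau> \<le> ?n" using n0 by linarith
    then have nM: "real M \<le> \<tau> * ?n / 2" using assms by (simp add: field_simps)
    define P where "P X \<longleftrightarrow> X \<subseteq> V \<and> card X = m \<and> homogeneous X \<and> (\<forall>x\<in>X. \<forall>y\<in>X. twins \<kappa> x y)" for X
    define \<F> where "\<F> = {F. (\<forall>X\<in>F. P X) \<and> pairwise disjnt F}"
    have "\<F> \<subseteq> Pow (Pow V)" by (auto simp: \<F>_def P_def)
    then have "finite \<F>" using fin finite_subset by blast
    moreover have "{} \<in> \<F>" by (simp add: \<F>_def)
    ultimately obtain F0 where F0: "F0 \<in> \<F>" and mx: "\<And>F. F \<in> \<F> \<Longrightarrow> F0 \<subseteq> F \<Longrightarrow> F0 = F"
      using finite_has_maximal[of \<F>] by auto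
    have F0P: "P X" if "X \<in> F0" for X using F0 that by (auto simp: \<F>_def)
    have F0V: "X \<subseteq> V" "finite X" "card X = m" if "X \<in> F0" for X
      using F0P[OF that] fin finite_subset by (auto simp: P_def)
    have dis: "pairwise disjnt F0" using F0 by (auto simp: \<F>_def)
    have finF0: "finite F0"
      using fin F0V by (meson Pow_iff finite_Pow_iff finite_subset subsetI)
    have "card (V - \<Union>F0) < M"
    proof (rule ccontr)
      assume "\<not> ?thesis"
      then have "finite_graph V E \<and> V - \<Union>F0 \<subseteq> V \<and> card (V - \<Union>F0) \<ge> M" using g by auto
      from M[rule_format, OF this] obtain X where X: "X \<subseteq> V - \<Union>F0" "P X"
        unfolding P_def by blast
      have "disjnt X Y \<and> disjnt Y X" if "Y \<in> F0" for Y
        using X(1) that unfolding disjnt_def by blast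
      then have "insert X F0 \<in> \<F>"
        using X(2) F0 unfolding \<F>_def mem_Collect_eq pairwise_insert by blast
      then have "X \<in> F0" using mx[of "insert X F0"] by auto
      then have "X = {}" using X by auto
      then show False using X m by (auto simp: P_def)
    qed
    then have rest: "real (card (V - \<Union>F0)) \<le> \<tau> * ?n / 2" using nM by linarith
    define D where "D X = {Y\<in>F0. \<not> agree \<tau> X Y}" for X
    define U where "U = unstable (\<tau> * ?n / 4)"
    have finU: "finite (U X)" for X using fin by (auto simp: U_def unstable_def)
    have cU: "card (U X) \<le> 4 * (real m)\<^sup>2 * \<kappa> * ?n / \<tau>" if "X \<in> F0" for X
    proof -
      have "\<tau> * ?n / 4 * card (U X) \<le> (real m)\<^sup>2 * \<kappa> * ?n\<^sup>2"
        unfolding U_def using F0P[OF that] assms n by (intro card_unstable) (auto simp: P_def)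
      then show ?thesis using n assms by (simp add: field_simps power2_eq_square)
    qed
    have cF0: "real m * card F0 \<le> ?n"
    proof -
      have "card (\<Union>F0) = (\<Sum>X\<in>F0. card X)"
        using dis F0V by (intro card_Union_disjoint) auto
      also have "\<dots> = card F0 * m" using F0V by simp
      finally have "card F0 * m \<le> card V"
        using card_mono[OF fin, of "\<Union>F0"] F0V by auto
      then show ?thesis by (metis mult.commute of_nat_le_iff of_nat_mult)
    qed
    \<comment> \<open>Disagreement forces one cluster to meet the unstable set of the other. Summed
      over all pairs the two cases contribute equally, and an unstable set meets at most as many
      disjoint clusters as it has elements.\<close>
    have sub: "D X \<subseteq> {Y\<in>F0. Y \<inter> U X \<noteq> {}} \<union> {Y\<in>F0. X \<inter> U Y \<noteq> {}}" if "X \<in> F0" for X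
    proof
      fix Y assume Y: "Y \<in> D X"
      then have "Y \<in> F0" by (auto simp: D_def)
      have "agree \<tau> X Y" if "Y \<inter> U X = {}" "X \<inter> U Y = {}"
        using F0P[OF \<open>X \<in> F0\<close>] F0P[OF \<open>Y \<in> F0\<close>] \<kappa>4 assms that unfolding P_def U_def
        by (intro agree_if_stable) auto
      then show "Y \<in> {Y\<in>F0. Y \<inter> U X \<noteq> {}} \<union> {Y\<in>F0. X \<inter> U Y \<noteq> {}}"
        using Y \<open>Y \<in> F0\<close> unfolding D_def by blast
    qed
    have "(\<Sum>X\<in>F0. card (D X)) \<le> (\<Sum>X\<in>F0. card {Y\<in>F0. Y \<inter> U X \<noteq> {}} + card {Y\<in>F0. X \<inter> U Y \<noteq> {}})"
    proof (intro sum_mono)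
      fix X assume "X \<in> F0"
      have "card (D X) \<le> card ({Y\<in>F0. Y \<inter> U X \<noteq> {}} \<union> {Y\<in>F0. X \<inter> U Y \<noteq> {}})"
        using sub[OF \<open>X \<in> F0\<close>] finF0 by (intro card_mono) auto
      also have "\<dots> \<le> card {Y\<in>F0. Y \<inter> U X \<noteq> {}} + card {Y\<in>F0. X \<inter> U Y \<noteq> {}}"
        by (rule card_Un_le)
      finally show "card (D X) \<le> card {Y\<in>F0. Y \<inter> U X \<noteq> {}} + card {Y\<in>F0. X \<inter> U Y \<noteq> {}}" .
    qed
    also have "\<dots> = 2 * (\<Sum>X\<in>F0. card {Y\<in>F0. Y \<inter> U X \<noteq> {}})"
      using sum_card_swap[OF finF0 finF0, of "\<lambda>X Y. X \<inter> U Y \<noteq> {}"] by (simp add: sum.distrib)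
    also have "\<dots> \<le> 2 * (\<Sum>X\<in>F0. card (U X))"
      using card_disjoint_meeting_le[OF dis finU] by (intro mult_left_mono sum_mono) auto
    finally have "real (\<Sum>X\<in>F0. card (D X)) \<le> real (2 * (\<Sum>X\<in>F0. card (U X)))"
      by (rule of_nat_mono)
    also have "\<dots> = 2 * (\<Sum>X\<in>F0. real (card (U X)))" by simp
    also have "\<dots> \<le> 2 * (\<Sum>X\<in>F0. 4 * (real m)\<^sup>2 * \<kappa> * ?n / \<tau>)"
      using cU by (intro mult_left_mono sum_mono) auto
    also have "\<dots> = 8 * real m * \<kappa> * ?n / \<tau> * (real m * card F0)"
      by (simp add: power2_eq_square)
    also have "\<dots> \<le> 8 * real m * \<kappa> * ?n / \<tau> * ?n"
      using cF0 \<kappa> assms by (intro mult_left_mono) auto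
    finally have tot: "(\<Sum>X\<in>F0. real (card (D X))) \<le> 8 * real m * \<kappa> * ?n / \<tau> * ?n" by simp
    define F where "F = {X\<in>F0. real (card (D X)) \<le> \<tau> * ?n / m}"
    have "F0 - F = {X\<in>F0. real (card (D X)) > \<tau> * ?n / m}" by (auto simp: F_def)
    then have "\<tau> * ?n / m * card (F0 - F) \<le> 8 * real m * \<kappa> * ?n / \<tau> * ?n"
      using markov_card[OF finF0, of "\<lambda>X. real (card (D X))" "\<tau> * ?n / m"] tot by simp
    then have "real m * card (F0 - F) \<le> 8 * real m ^ 3 * \<kappa> * ?n / \<tau>\<^sup>2"
      using n assms by (simp add: field_simps power2_eq_square power3_eq_cube)
    also have "\<dots> = \<tau> * ?n / 2"
      using assms by (simp add: \<kappa>_def field_simps power2_eq_square power3_eq_cube)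
    finally have out: "real m * card (F0 - F) \<le> \<tau> * ?n / 2" .
    have cUn: "real (card (\<Union>A)) \<le> real m * card A" if "A \<subseteq> F0" for A
    proof -
      have "card (\<Union>A) \<le> (\<Sum>X\<in>A. card X)" by (rule card_Union_le_sum_card)
      also have "\<dots> = card A * m" using that F0V by (simp add: subset_iff)
      finally show ?thesis by (metis mult.commute of_nat_le_iff of_nat_mult)
    qed
    have "card (V - \<Union>F) \<le> card ((V - \<Union>F0) \<union> \<Union>(F0 - F))"
      using fin F0V finF0 by (intro card_mono) auto
    also have "\<dots> \<le> card (V - \<Union>F0) + card (\<Union>(F0 - F))" by (rule card_Un_le)
    finally have 1: "real (card (V - \<Union>F)) \<le> \<tau> * ?n"
      using rest cUn[of "F0 - F"] out by simp
    have 2: "real (card (\<Union>{Y\<in>F. \<not> agree \<tau> X Y})) \<le> \<tau> * ?n" if "X \<in> F" for X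
    proof -
      have "card (\<Union>{Y\<in>F. \<not> agree \<tau> X Y}) \<le> card (\<Union>(D X))"
        using finF0 F0V by (intro card_mono) (auto simp: D_def F_def)
      moreover have "real (card (\<Union>(D X))) \<le> real m * card (D X)"
        by (intro cUn) (auto simp: D_def)
      moreover have "real m * card (D X) \<le> \<tau> * ?n"
        using that m by (simp add: F_def field_simps)
      ultimately show ?thesis by linarith
    qed
    show "\<exists>F. (\<forall>X\<in>F. X \<subseteq> V \<and> card X = m \<and> homogeneous X) \<and> pairwise disjnt F \<and>
      card (V - \<Union>F) \<le> \<tau> * card V \<and> (\<forall>X\<in>F. card (\<Union>{Y\<in>F. \<not> agree \<tau> X Y}) \<le> \<tau> * card V)"
    proof (intro exI[of _ F] conjI ballI)
      show "pairwise disjnt F" using dis by (rule pairwise_subset) (auto simp: F_def)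
      fix X assume "X \<in> F"
      then have "P X" by (simp add: F_def F0P)
      then show "X \<subseteq> V" "card X = m" "homogeneous X" by (simp_all add: P_def)
    qed (use 1 2 in blast)+
  qed
qed

subsection \<open>Nearly complete bipartite cores\<close>

text \<open>Here \<open>|V| = 2q + 3\<close>. Since \<open>ccod x y\<close> counts \<open>x\<close> and \<open>y\<close> too, at most \<open>q - 1\<close> common blue
  neighbours means \<open>ccod x y \<le> q + 1\<close>.\<close>

locale book_avoiding = finite_graph +
  fixes \<beta> :: real
  assumes red: "x \<in> V \<Longrightarrow> y \<in> V \<Longrightarrow> E x y \<Longrightarrow> cod x y \<le> \<beta> * card V"
    and blue: "x \<in> V \<Longrightarrow> y \<in> V \<Longrightarrow> x \<noteq> y \<Longrightarrow> \<not> E x y \<Longrightarrow> 2 * ccod x y \<le> real (card V) - 1"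
    and \<beta>_le: "\<beta> \<le> 1 / 12"
begin

lemma red_le: "x \<in> V \<Longrightarrow> y \<in> V \<Longrightarrow> E x y \<Longrightarrow> cod x y \<le> card V / 12"
  using red[of x y] mult_right_mono[OF \<beta>_le, of "card V"] by simp

lemma blue_le: "x \<in> V \<Longrightarrow> y \<in> V \<Longrightarrow> x \<noteq> y \<Longrightarrow> \<not> E x y \<Longrightarrow> ccod x y \<le> card V / 2"
  using blue[of x y] by simp

text \<open>Two vertices of \<open>A\<close> have all of \<open>S\<close> as common blue neighbours,
  together with part of \<open>L\<close>. Each vertex of \<open>L\<close> is blue to at least 19/25
  of \<open>A\<close>, hence to (19/25)^2 > 1/2 of the pairs, so some pair has at least half of
  \<open>L\<close> in common as well.\<close>

lemma independent_side_bound: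
  assumes A: "A \<subseteq> V" "card A \<ge> 2 / 5 * card V" and n: "card V \<ge> 100"
    and indep: "\<And>a a'. a \<in> A \<Longrightarrow> a' \<in> A \<Longrightarrow> \<not> E a a'"
    and S: "S \<subseteq> V" "\<And>w a. w \<in> S \<Longrightarrow> a \<in> A \<Longrightarrow> \<not> E w a"
    and L: "L \<subseteq> V" "L \<inter> S = {}" "\<And>w. w \<in> L \<Longrightarrow> (\<Sum>a\<in>A. ind w a) \<le> card V / 12 + card V / 100"
  shows "card S + card L / 2 \<le> (real (card V) - 1) / 2"
proof -
  let ?n = "real (card V)" and ?s = "real (card A)" and ?l = "real (card L)"
  define c where "c = (?n - 1) / 2 - card S"
  define g where "g a a' = (\<Sum>w\<in>L. (1 - ind a w) * (1 - ind a' w))" for a a'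
  have finA: "finite A" "finite S" "finite L" using A S L fin finite_subset by auto
  have s: "?s \<ge> 40" using A(2) n by linarith
  have gl: "g a a' \<le> ?l" for a a'
  proof -
    have "g a a' \<le> (\<Sum>w\<in>L. 1)" unfolding g_def by (intro sum_mono) (auto simp: ind_def)
    then show ?thesis by simp
  qed
  have gc: "g a a' \<le> c" if "a \<in> A" "a' \<in> A" "a \<noteq> a'" for a a'
  proof -
    have "card S + g a a' = (\<Sum>w\<in>S. (1 - ind a w) * (1 - ind a' w)) + g a a'"
    proof -
      have "(\<Sum>w\<in>S. (1 - ind a w) * (1 - ind a' w)) = (\<Sum>w\<in>S. 1)"
        using that S(2) sym by (intro sum.cong) (auto simp: ind_def)
      then show ?thesis by simp
    qed
    also have "\<dots> = (\<Sum>w\<in>S \<union> L. (1 - ind a w) * (1 - ind a' w))"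
      unfolding g_def using finA L(2) by (subst sum.union_disjoint) auto
    also have "\<dots> \<le> ccod a a'"
      unfolding ccod_def using S(1) L(1) fin by (intro sum_mono2) auto
    also have "\<dots> \<le> (?n - 1) / 2"
      using blue[of a a'] indep that A(1) by (auto simp: subset_iff)
    finally show ?thesis unfolding c_def by linarith
  qed
  have c0: "c \<ge> 0"
  proof -
    have "2 \<le> card A" using s by linarith
    then obtain T where "T \<subseteq> A" "card T = 2"
      by (metis obtain_subset_with_card_n)
    then obtain a a' where a: "a \<in> A" "a' \<in> A" "a \<noteq> a'"
      by (auto simp: card_2_iff)
    have "0 \<le> g a a'" unfolding g_def by (intro sum_nonneg) auto
    then show ?thesis using gc[OF a] by linarith
  qed
  \<comment> \<open>As \<open>card A\<close> is at least 2/5 of |V|, the red degree bound of (1/12 +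
    1/100) |V| is at most 7/30 of \<open>card A\<close>, below 6/25.\<close>
  have "(\<Sum>w\<in>L. (19 / 25 * ?s)\<^sup>2) \<le> (\<Sum>w\<in>L. (\<Sum>a\<in>A. 1 - ind a w)\<^sup>2)"
  proof (intro sum_mono power_mono)
    fix w assume "w \<in> L"
    then have "(\<Sum>a\<in>A. ind a w) \<le> ?n / 12 + ?n / 100"
      using L(3)[of w] by (simp add: ind_sym[of w])
    then show "19 / 25 * ?s \<le> (\<Sum>a\<in>A. 1 - ind a w)"
      using A(2) by (simp add: sum_subtractf)
  qed auto
  also have "\<dots> = (\<Sum>a\<in>A. \<Sum>a'\<in>A. g a a')"
    unfolding g_def power2_eq_square sum_product
    by (simp only: sum.swap[of _ L A])
  also have "\<dots> \<le> (\<Sum>a\<in>A. \<Sum>a'\<in>A. c + (if a = a' then ?l else 0))"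
  proof (intro sum_mono)
    fix a a' assume "a \<in> A" "a' \<in> A"
    then show "g a a' \<le> c + (if a = a' then ?l else 0)"
      using gl[of a a'] gc[of a a'] c0 by auto
  qed
  also have "\<dots> = ?s * ?s * c + ?s * ?l"
    using finA by (simp add: sum.distrib algebra_simps)
  finally have "?s * ((19 / 25)\<^sup>2 * ?s * ?l) \<le> ?s * (?s * c + ?l)"
    by (simp add: power2_eq_square algebra_simps)
  then have "(19 / 25)\<^sup>2 * ?s * ?l \<le> ?s * c + ?l" using s by simp
  \<comment> \<open>The diagonal pairs cost one extra \<open>?l\<close>, absorbed because (19/25)^2
    - 1/2 exceeds 1/40.\<close>
  moreover have "?l * 40 \<le> ?l * ?s" using s by (intro mult_left_mono) auto
  ultimately have "?s * (?l / 2) \<le> ?s * c" by (simp add: power2_eq_square algebra_simps)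
  then have "?l / 2 \<le> c" using s by simp
  then show ?thesis unfolding c_def by argo
qed

text \<open>Nearly all of \<open>B\<close> is red to \<open>a\<close>, so the red neighbours of
  \<open>w\<close> in \<open>B\<close> are, up to |V|/100, common red neighbours of the red edge
  from \<open>w\<close> to \<open>a\<close>.\<close>

lemma red_degree_into_opposite_side:
  assumes "w \<in> V" "a \<in> V" "E w a" "B \<subseteq> V" "(\<Sum>b\<in>B. 1 - ind a b) \<le> card V / 100"
  shows "(\<Sum>b\<in>B. ind w b) \<le> card V / 12 + card V / 100"
proof -
  have "(\<Sum>b\<in>B. ind w b) - (\<Sum>b\<in>B. 1 - ind a b) = (\<Sum>b\<in>B. ind w b - (1 - ind a b))"
    by (simp add: sum_subtractf)
  also have "\<dots> \<le> (\<Sum>b\<in>B. ind w b * ind a b)"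
    by (intro sum_mono) (auto simp: ind_def)
  also have "\<dots> \<le> cod w a"
    unfolding cod_def using fin assms(4) by (intro sum_mono2) auto
  also have "\<dots> \<le> card V / 12" using assms by (intro red_le) auto
  finally show ?thesis using assms(5) by linarith
qed

lemma side_independent:
  assumes A: "A \<subseteq> V" and B: "B \<subseteq> V" "card B \<ge> 2 / 5 * card V"
    and miss: "\<And>a. a \<in> A \<Longrightarrow> (\<Sum>b\<in>B. 1 - ind a b) \<le> card V / 100"
    and a: "a \<in> A" "a' \<in> A" and n: "card V > 0"
  shows "\<not> E a a'"
proof
  assume "E a a'"
  then have "(\<Sum>b\<in>B. ind a b) \<le> card V / 12 + card V / 100"
    using A B miss a by (intro red_degree_into_opposite_side[of a a']) auto
  moreover have "(\<Sum>b\<in>B. ind a b) = card B - (\<Sum>b\<in>B. 1 - ind a b)"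
    by (simp add: sum_subtractf)
  moreover have "(\<Sum>b\<in>B. 1 - ind a b) \<le> card V / 100" using miss a by auto
  moreover have "real (card V) > 0" using n by simp
  ultimately show False using B(2) by linarith
qed

text \<open>A vertex outside a nearly complete bipartite core \<open>A, B\<close> has no red neighbour on one of the two
  sides, or only few red neighbours on both. In the second case it is a common blue neighbour of
  more than half of the pairs in \<open>A\<close> and of more than half of those in \<open>B\<close>.\<close>

lemma no_bipartite_core:
  assumes A: "A \<subseteq> V" "card A \<ge> 2 / 5 * card V" and B: "B \<subseteq> V" "card B \<ge> 2 / 5 * card V"
    and missA: "\<And>a. a \<in> A \<Longrightarrow> (\<Sum>b\<in>B. 1 - ind a b) \<le> card V / 100"
    and missB: "\<And>b. b \<in> B \<Longrightarrow> (\<Sum>a\<in>A. 1 - ind b a) \<le> card V / 100"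
    and n: "card V \<ge> 100"
  shows False
proof -
  define SA where "SA = {w\<in>V. \<forall>a\<in>A. \<not> E w a}"
  define SB where "SB = {w\<in>V. \<forall>b\<in>B. \<not> E w b}"
  define L where "L = V - SA - SB"
  have LB: "(\<Sum>b\<in>B. ind w b) \<le> card V / 12 + card V / 100" if w: "w \<in> L" for w
  proof -
    obtain a where "a \<in> A" "E w a" using w by (auto simp: L_def SA_def)
    then show ?thesis using that A B missA
      by (intro red_degree_into_opposite_side[of w a]) (auto simp: L_def)
  qed
  have LA: "(\<Sum>a\<in>A. ind w a) \<le> card V / 12 + card V / 100" if w: "w \<in> L" for w
  proof -
    obtain b where "b \<in> B" "E w b" using w by (auto simp: L_def SB_def)
    then show ?thesis using that A B missB
      by (intro red_degree_into_opposite_side[of w b]) (auto simp: L_def)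
  qed
  have "card SA + card L / 2 \<le> (real (card V) - 1) / 2"
  proof (rule independent_side_bound[OF A n _ _ _ _ _ LA])
    show "\<not> E a a'" if "a \<in> A" "a' \<in> A" for a a'
      using side_independent[OF A(1) B missA that] n by simp
  qed (auto simp: SA_def L_def)
  moreover have "card SB + card L / 2 \<le> (real (card V) - 1) / 2"
  proof (rule independent_side_bound[OF B n _ _ _ _ _ LB])
    show "\<not> E b b'" if "b \<in> B" "b' \<in> B" for b b'
      using side_independent[OF B(1) A missB that] n by simp
  qed (auto simp: SB_def L_def)
  \<comment> \<open>The two bounds add up to |SA| + |SB| + |L| \<le> |V| - 1, while the three sets
    cover \<open>V\<close>. The contradiction rests on the exact \<open>- 1\<close> in the
    assumption \<open>blue\<close>.\<close>
  moreover have "card V \<le> card SA + card SB + card L"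
  proof -
    have "V = SA \<union> SB \<union> L" by (auto simp: SA_def SB_def L_def)
    then show ?thesis by (metis (no_types) card_Un_le add_le_mono1 order_trans)
  qed
  then have "real (card V) \<le> real (card SA) + real (card SB) + real (card L)" by linarith
  ultimately show False by argo
qed

lemma card_few_misses:
  assumes A: "A \<subseteq> V" "card A \<ge> 9 / 20 * card V"
    and miss: "(\<Sum>a\<in>A. f a) \<le> (real (card V))\<^sup>2 / 10000" and f: "\<And>a. f a \<ge> (0 :: real)"
    and n: "card V > 0"
  shows "card {a\<in>A. f a \<le> card V / 100} \<ge> 2 / 5 * card V"
proof -
  let ?n = "real (card V)"
  have finA: "finite A" using A fin finite_subset by auto
  have "?n / 100 * card {a\<in>A. f a > ?n / 100} \<le> ?n\<^sup>2 / 10000"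
    using markov_card[where f = f and c = "?n / 100", OF finA f] miss by linarith
  then have "real (card {a\<in>A. f a > ?n / 100}) \<le> ?n / 100"
    using n by (simp add: power2_eq_square field_simps)
  moreover have "card A = card {a\<in>A. f a \<le> ?n / 100} + card {a\<in>A. f a > ?n / 100}"
    using finA by (subst card_Un_disjoint[symmetric]) (auto intro: arg_cong[of _ _ card])
  ultimately show ?thesis using A(2) by simp
qed

text \<open>Removing the vertices that miss more than |V|/100 of the opposite side turns the average
  density into the degree conditions of a core, and costs at most |V|/100 vertices per side.\<close>

lemma no_dense_bipartite_pair:
  assumes A: "A \<subseteq> V" "card A \<ge> 9 / 20 * card V" and B: "B \<subseteq> V" "card B \<ge> 9 / 20 * card V"
    and miss: "(\<Sum>a\<in>A. \<Sum>b\<in>B. 1 - ind a b) \<le> (real (card V))\<^sup>2 / 10000"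
    and n: "card V \<ge> 100"
  shows False
proof -
  define A' where "A' = {a\<in>A. (\<Sum>b\<in>B. 1 - ind a b) \<le> card V / 100}"
  define B' where "B' = {b\<in>B. (\<Sum>a\<in>A. 1 - ind b a) \<le> card V / 100}"
  have finAB: "finite A" "finite B" using A B fin finite_subset by auto
  have "(\<Sum>b\<in>B. \<Sum>a\<in>A. 1 - ind b a) \<le> (real (card V))\<^sup>2 / 10000"
    using miss ind_sym by (subst sum.swap) simp
  then have "card B' \<ge> 2 / 5 * card V"
    unfolding B'_def using n by (intro card_few_misses[OF B]) (auto intro: sum_nonneg)
  moreover have "card A' \<ge> 2 / 5 * card V"
    unfolding A'_def using n miss by (intro card_few_misses[OF A]) (auto intro: sum_nonneg)
  ultimately have cards: "card A' \<ge> 2 / 5 * card V" "card B' \<ge> 2 / 5 * card V" by auto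
  show False
  proof (rule no_bipartite_core[OF _ cards(1) _ cards(2) _ _ n])
    fix a assume a: "a \<in> A'"
    have "(\<Sum>b\<in>B'. 1 - ind a b) \<le> (\<Sum>b\<in>B. 1 - ind a b)"
      using finAB by (intro sum_mono2) (auto simp: B'_def)
    then show "(\<Sum>b\<in>B'. 1 - ind a b) \<le> card V / 100" using a by (auto simp: A'_def)
  next
    fix b assume b: "b \<in> B'"
    have "(\<Sum>a\<in>A'. 1 - ind b a) \<le> (\<Sum>a\<in>A. 1 - ind b a)"
      using finAB by (intro sum_mono2) (auto simp: A'_def)
    then show "(\<Sum>a\<in>A'. 1 - ind b a) \<le> card V / 100" using b by (auto simp: B'_def)
  qed (use A B in \<open>auto simp: A'_def B'_def\<close>)
qed

end

subsection \<open>Clusters in a graph without large books\<close>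

lemma sum_product_averages:
  fixes h :: "'a \<Rightarrow> 'b \<Rightarrow> real"
  shows "(\<Sum>v\<in>V. ((\<Sum>x\<in>X. h x v) / m) * ((\<Sum>y\<in>Y. h y v) / m))
    = (\<Sum>x\<in>X. \<Sum>y\<in>Y. \<Sum>v\<in>V. h x v * h y v) / m\<^sup>2"
proof -
  have "(\<Sum>v\<in>V. ((\<Sum>x\<in>X. h x v) / m) * ((\<Sum>y\<in>Y. h y v) / m))
    = (\<Sum>v\<in>V. \<Sum>x\<in>X. \<Sum>y\<in>Y. h x v * h y v) / m\<^sup>2"
    by (simp add: sum_divide_distrib[symmetric] sum_product power2_eq_square)
  also have "(\<Sum>v\<in>V. \<Sum>x\<in>X. \<Sum>y\<in>Y. h x v * h y v) = (\<Sum>x\<in>X. \<Sum>v\<in>V. \<Sum>y\<in>Y. h x v * h y v)"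
    by (rule sum.swap)
  also have "\<dots> = (\<Sum>x\<in>X. \<Sum>y\<in>Y. \<Sum>v\<in>V. h x v * h y v)"
    by (intro sum.cong refl sum.swap)
  finally show ?thesis .
qed

lemma average_le:
  fixes c :: "'a \<Rightarrow> 'a \<Rightarrow> real"
  assumes "card X = m" "card Y = m" "m \<ge> 1" "\<And>x y. x \<in> X \<Longrightarrow> y \<in> Y \<Longrightarrow> c x y \<le> C"
  shows "(\<Sum>x\<in>X. \<Sum>y\<in>Y. c x y) / (real m)\<^sup>2 \<le> C"
proof -
  have "(\<Sum>x\<in>X. \<Sum>y\<in>Y. c x y) \<le> (\<Sum>x\<in>X. \<Sum>y\<in>Y. C)"
    using assms by (intro sum_mono) auto
  also have "\<dots> = C * (real m)\<^sup>2" using assms by (simp add: power2_eq_square)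
  finally show ?thesis using assms by (simp add: divide_le_eq)
qed

lemma average_le_diagonal:
  fixes c :: "'a \<Rightarrow> 'a \<Rightarrow> real"
  assumes "card X = m" "m \<ge> 1" "\<And>x y. x \<in> X \<Longrightarrow> y \<in> X \<Longrightarrow> x \<noteq> y \<Longrightarrow> c x y \<le> C"
    and "\<And>x. x \<in> X \<Longrightarrow> c x x \<le> D" and "C \<ge> 0"
  shows "(\<Sum>x\<in>X. \<Sum>y\<in>X. c x y) / (real m)\<^sup>2 \<le> C + D / m"
proof -
  have finX: "finite X" using assms by (auto intro: card_ge_0_finite)
  have "(\<Sum>x\<in>X. \<Sum>y\<in>X. c x y) \<le> (\<Sum>x\<in>X. \<Sum>y\<in>X. C + (if x = y then D else 0))"
    using assms by (intro sum_mono) (auto simp: add_increasing)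
  also have "\<dots> = (C + D / m) * (real m)\<^sup>2"
    using assms finX by (simp add: sum.distrib power2_eq_square algebra_simps)
  finally show ?thesis using assms by (simp add: divide_le_eq)
qed

lemma sum_square_shift:
  fixes f :: "'a \<Rightarrow> real"
  shows "(\<Sum>v\<in>V. (f v - c)\<^sup>2) = (\<Sum>v\<in>V. f v * f v) - 2 * c * (\<Sum>v\<in>V. f v) + c\<^sup>2 * card V"
proof -
  have "(f v - c)\<^sup>2 = f v * f v - 2 * c * f v + c\<^sup>2" for v
    by (simp add: power2_eq_square algebra_simps)
  then show ?thesis by (simp add: sum.distrib sum_subtractf sum_distrib_left)
qed

text \<open>The bounds on \<open>m\<close> make diagonal terms and single clusters cost at most
  \<open>\<tau> * card V\<close>. A triangle of linked blue clusters would violate the strict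
  inequality between \<beta> and \<tau>.\<close>

locale clustered = book_avoiding +
  fixes F :: "'a set set" and m :: nat and \<tau> :: real
  assumes F: "X \<in> F \<Longrightarrow> X \<subseteq> V" "X \<in> F \<Longrightarrow> card X = m" "X \<in> F \<Longrightarrow> homogeneous X"
    and disjoint: "pairwise disjnt F"
    and rest: "card (V - \<Union>F) \<le> \<tau> * card V"
    and disagree: "X \<in> F \<Longrightarrow> card (\<Union>{Y\<in>F. \<not> agree \<tau> X Y}) \<le> \<tau> * card V"
    and m: "m \<ge> 1" "1 / m \<le> \<tau>" "m \<le> \<tau> * card V"
    and \<tau>: "6 * \<beta> + 9 * \<tau> < 1 / 2" "0 < \<tau>" "\<tau> \<le> 1 / 10 ^ 13"
begin

abbreviation n :: real where "n \<equiv> real (card V)"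

text \<open>Inner products of these functions are average codegrees between clusters.\<close>

definition avg :: "'a set \<Rightarrow> 'a \<Rightarrow> real" where "avg X v = (\<Sum>x\<in>X. ind x v) / m"

definition linked :: "'a set \<Rightarrow> 'a set \<Rightarrow> bool" where
  "linked X Y \<longleftrightarrow> agree \<tau> X Y \<and> (\<exists>x\<in>X. \<exists>y\<in>Y. E x y)"

definition blue_clusters :: "'a set set" where "blue_clusters = {X\<in>F. \<forall>x\<in>X. \<forall>y\<in>X. \<not> E x y}"
definition red_clusters :: "'a set set" where "red_clusters = F - blue_clusters"

definition bad :: "'a set \<Rightarrow> 'a set" where "bad X = \<Union>{Y\<in>F. \<not> agree \<tau> X Y}"

definition links :: "'a set \<Rightarrow> 'a set set" where "links Y = {U\<in>blue_clusters. linked Y U}"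

lemma n_pos: "n > 0"
  using m \<tau> by (cases "card V = 0") auto

lemma blue_cluster_F: "X \<in> blue_clusters \<Longrightarrow> X \<in> F" and red_cluster_F: "X \<in> red_clusters \<Longrightarrow> X \<in> F"
  by (auto simp: blue_clusters_def red_clusters_def)

lemma blue_cluster_indep: "X \<in> blue_clusters \<Longrightarrow> x \<in> X \<Longrightarrow> y \<in> X \<Longrightarrow> \<not> E x y"
  by (auto simp: blue_clusters_def)

lemma red_cluster_clique: "X \<in> red_clusters \<Longrightarrow> x \<in> X \<Longrightarrow> y \<in> X \<Longrightarrow> x \<noteq> y \<Longrightarrow> E x y"
  using F(3)[of X] unfolding red_clusters_def blue_clusters_def homogeneous_def by blast

lemma F_finite: "X \<in> F \<Longrightarrow> finite X"
  using F(1) fin finite_subset by blast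

lemma finite_F: "finite F"
  using F(1) fin by (meson Pow_iff finite_Pow_iff finite_subset subsetI)

lemma F_mem_V: "X \<in> F \<Longrightarrow> x \<in> X \<Longrightarrow> x \<in> V"
  using F(1) by blast

lemma F_disjoint: "X \<in> F \<Longrightarrow> Y \<in> F \<Longrightarrow> X \<noteq> Y \<Longrightarrow> X \<inter> Y = {}"
  using disjoint by (simp add: pairwise_def disjnt_def)

lemma Union_clusters_disjoint:
  assumes "A \<subseteq> F" "B \<subseteq> F" "A \<inter> B = {}"
  shows "\<Union>A \<inter> \<Union>B = {}"
proof -
  have "X \<inter> Y = {}" if "X \<in> A" "Y \<in> B" for X Y
    using that assms by (intro F_disjoint) auto
  then show ?thesis by blast
qed

lemma sum_Union: "A \<subseteq> F \<Longrightarrow> (\<Sum>v\<in>\<Union>A. g v) = (\<Sum>X\<in>A. \<Sum>v\<in>X. (g v :: real))"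
  using F_finite F_disjoint by (subst sum.Union_disjoint) (auto simp: subset_iff)

lemma card_Union: "A \<subseteq> F \<Longrightarrow> real (card (\<Union>A)) = real m * card A"
  using sum_Union[of A "\<lambda>_. 1"] F(2) by (simp add: subset_iff)

section \<open>Norms and inner products of cluster averages\<close>

lemma one_minus_avg: "X \<in> F \<Longrightarrow> 1 - avg X v = (\<Sum>x\<in>X. 1 - ind x v) / m"
  using F(2) m(1) by (simp add: avg_def sum_subtractf diff_divide_distrib)

lemma avg_nonneg: "0 \<le> avg X v"
  unfolding avg_def by (intro divide_nonneg_nonneg sum_nonneg) auto

lemma avg_le_1: "X \<in> F \<Longrightarrow> avg X v \<le> 1"
proof -
  assume "X \<in> F"
  then have "0 \<le> 1 - avg X v"
    unfolding one_minus_avg[OF \<open>X \<in> F\<close>] by (intro divide_nonneg_nonneg sum_nonneg) auto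
  then show ?thesis by simp
qed

lemma inner_avg: "(\<Sum>v\<in>V. avg X v * avg Y v) = (\<Sum>x\<in>X. \<Sum>y\<in>Y. cod x y) / (real m)\<^sup>2"
  unfolding avg_def cod_def by (rule sum_product_averages)

lemma inner_co_avg:
  "X \<in> F \<Longrightarrow> Y \<in> F \<Longrightarrow>
    (\<Sum>v\<in>V. (1 - avg X v) * (1 - avg Y v)) = (\<Sum>x\<in>X. \<Sum>y\<in>Y. ccod x y) / (real m)\<^sup>2"
  unfolding ccod_def by (simp only: one_minus_avg sum_product_averages)

lemma inner_co_avg':
  "(\<Sum>v\<in>V. (1 - avg X v) * (1 - avg Y v))
    = n - (\<Sum>v\<in>V. avg X v) - (\<Sum>v\<in>V. avg Y v) + (\<Sum>v\<in>V. avg X v * avg Y v)"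
  by (simp add: algebra_simps sum.distrib sum_subtractf)

lemma n_div_m: "n / m \<le> \<tau> * n"
  using mult_right_mono[OF m(2), of n] by simp

text \<open>Distinct vertices of a blue cluster are blue pairs, with \<open>ccod\<close> at most
  n/2; the diagonal adds at most n/m.\<close>

lemma blue_cluster_norm: "X \<in> blue_clusters \<Longrightarrow> (\<Sum>v\<in>V. (1 - avg X v)\<^sup>2) \<le> n / 2 + \<tau> * n"
proof -
  assume X: "X \<in> blue_clusters"
  have "(\<Sum>v\<in>V. (1 - avg X v)\<^sup>2) = (\<Sum>x\<in>X. \<Sum>y\<in>X. ccod x y) / (real m)\<^sup>2"
    using inner_co_avg[of X X] blue_cluster_F[OF X] by (simp add: power2_eq_square)
  also have "\<dots> \<le> n / 2 + n / m"
    using F(2)[OF blue_cluster_F[OF X]] m(1) ccod_le blue_cluster_indep[OF X] F_mem_V[OF blue_cluster_F[OF X]]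
    by (intro average_le_diagonal blue_le) auto
  finally show ?thesis using n_div_m by simp
qed

lemma red_cluster_norm: "X \<in> red_clusters \<Longrightarrow> (\<Sum>v\<in>V. (avg X v)\<^sup>2) \<le> n / 12 + \<tau> * n"
proof -
  assume X: "X \<in> red_clusters"
  have "(\<Sum>v\<in>V. (avg X v)\<^sup>2) = (\<Sum>x\<in>X. \<Sum>y\<in>X. cod x y) / (real m)\<^sup>2"
    using inner_avg[of X X] by (simp add: power2_eq_square)
  also have "\<dots> \<le> n / 12 + n / m"
    using F(2)[OF red_cluster_F[OF X]] m(1) cod_le red_cluster_clique[OF X] F_mem_V[OF red_cluster_F[OF X]]
    by (intro average_le_diagonal red_le) auto
  finally show ?thesis using n_div_m by simp
qed

lemma linked_inner:
  assumes "X \<in> F" "Y \<in> F" "linked X Y"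
  shows "(\<Sum>v\<in>V. avg X v * avg Y v) \<le> \<beta> * n + \<tau> * n"
proof -
  obtain x0 y0 where x0: "x0 \<in> X" "y0 \<in> Y" "E x0 y0" using assms(3) by (auto simp: linked_def)
  then have c0: "cod x0 y0 \<le> \<beta> * n" using assms F_mem_V by (intro red) auto
  show ?thesis unfolding inner_avg
  proof (intro average_le F(2) assms m(1))
    fix x y assume "x \<in> X" "y \<in> Y"
    then have "\<bar>cod x y - cod x0 y0\<bar> \<le> \<tau> * n"
      using assms(3) x0 by (auto simp: linked_def agree_def)
    then show "cod x y \<le> \<beta> * n + \<tau> * n" using c0 by linarith
  qed
qed

lemma non_adjacent_inner:
  assumes "X \<in> F" "Y \<in> F" "X \<noteq> Y" "agree \<tau> X Y" "x0 \<in> X" "y0 \<in> Y" "\<not> E x0 y0"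
  shows "(\<Sum>v\<in>V. (1 - avg X v) * (1 - avg Y v)) \<le> n / 2 + \<tau> * n"
proof -
  have "x0 \<noteq> y0" using assms F_disjoint[of X Y] by auto
  then have c0: "ccod x0 y0 \<le> n / 2" using assms F_mem_V by (intro blue_le) auto
  show ?thesis unfolding inner_co_avg[OF assms(1,2)]
  proof (intro average_le F(2) assms m(1))
    fix x y assume "x \<in> X" "y \<in> Y"
    then have "\<bar>ccod x y - ccod x0 y0\<bar> \<le> \<tau> * n"
      using assms by (auto simp: agree_def)
    then show "ccod x y \<le> n / 2 + \<tau> * n" using c0 by linarith
  qed
qed

text \<open>The constant \<open>1/12\<close> of the theorem enters here: expand
  \<open>\<Sum>v. (avg X v + avg Y v + avg Z v - 1)\<^sup>2 \<ge> 0\<close>.\<close>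

lemma no_linked_triangle:
  assumes "X \<in> blue_clusters" "Y \<in> blue_clusters" "Z \<in> blue_clusters" "linked X Y" "linked Y Z" "linked X Z"
  shows False
proof -
  let ?S = "\<lambda>X Y. \<Sum>v\<in>V. avg X v * avg Y v" and ?D = "\<lambda>X. \<Sum>v\<in>V. avg X v"
  \<comment> \<open>The norm bound for 1 - \<open>avg W\<close>, rewritten so that the linear terms
    cancel in the expansion. The norms contribute -3n/2 against the constant n, and the doubled
    inner products at most \<open>6 * (\<beta> + \<tau>) * n\<close>.\<close>
  have norm: "?S W W \<le> 2 * ?D W - n / 2 + \<tau> * n" if "W \<in> blue_clusters" for W
    using blue_cluster_norm[OF that] inner_co_avg'[of W W] by (simp add: power2_eq_square)
  have "0 \<le> (\<Sum>v\<in>V. (avg X v + avg Y v + avg Z v - 1)\<^sup>2)" by (intro sum_nonneg) auto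
  also have "\<dots> = ?S X X + ?S Y Y + ?S Z Z + 2 * ?S X Y + 2 * ?S Y Z + 2 * ?S X Z
      - 2 * ?D X - 2 * ?D Y - 2 * ?D Z + n"
    by (simp add: power2_eq_square algebra_simps sum.distrib sum_subtractf sum_distrib_left)
  also have "\<dots> \<le> (6 * \<beta> + 9 * \<tau>) * n - n / 2"
    using norm[OF assms(1)] norm[OF assms(2)] norm[OF assms(3)]
      linked_inner[OF blue_cluster_F[OF assms(1)] blue_cluster_F[OF assms(2)] assms(4)]
      linked_inner[OF blue_cluster_F[OF assms(2)] blue_cluster_F[OF assms(3)] assms(5)]
      linked_inner[OF blue_cluster_F[OF assms(1)] blue_cluster_F[OF assms(3)] assms(6)]
    by (simp add: algebra_simps)
  also have "\<dots> < 1 / 2 * n - n / 2"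
    using \<tau>(1) n_pos by (intro diff_strict_right_mono mult_strict_right_mono) auto
  finally show False by simp
qed

text \<open>A blue pair would force the sums of \<open>avg X\<close> and \<open>avg Y\<close> to
  total at least about 0.59 n, but the norm bounds allow only about n/sqrt(12), that is 0.289 n, for
  each. The centres 3/5 and 29/100 are rational values near 2/sqrt(12) and 1/sqrt(12).\<close>

lemma red_cluster_complete:
  assumes X: "X \<in> red_clusters" "Y \<in> red_clusters" "X \<noteq> Y" "agree \<tau> X Y" and xy: "x \<in> X" "y \<in> Y"
  shows "E x y"
proof (rule ccontr)
  assume "\<not> E x y"
  let ?S = "\<lambda>X Y. \<Sum>v\<in>V. avg X v * avg Y v" and ?D = "\<lambda>X. \<Sum>v\<in>V. avg X v"
  have 1: "?S X Y \<le> ?D X + ?D Y - n / 2 + \<tau> * n"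
    using non_adjacent_inner[OF red_cluster_F[OF X(1)] red_cluster_F[OF X(2)] X(3,4) xy \<open>\<not> E x y\<close>] inner_co_avg'[of X Y]
    by simp
  have norm: "?S W W \<le> n / 12 + \<tau> * n" if "W \<in> red_clusters" for W
    using red_cluster_norm[OF that] by (simp add: power2_eq_square)
  have "0 \<le> (\<Sum>v\<in>V. (avg X v + avg Y v - 3 / 5)\<^sup>2)" by (intro sum_nonneg) auto
  also have "\<dots> = (\<Sum>v\<in>V. (avg X v + avg Y v) * (avg X v + avg Y v))
      - 2 * (3 / 5) * (\<Sum>v\<in>V. avg X v + avg Y v) + (3 / 5)\<^sup>2 * n"
    by (rule sum_square_shift)
  also have "(\<Sum>v\<in>V. (avg X v + avg Y v) * (avg X v + avg Y v)) = ?S X X + ?S Y Y + 2 * ?S X Y"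
    by (simp add: algebra_simps sum.distrib flip: sum_distrib_left)
  also have "(\<Sum>v\<in>V. avg X v + avg Y v) = ?D X + ?D Y" by (rule sum.distrib)
  finally have 2: "0 \<le> ?S X X + ?S Y Y + 2 * ?S X Y - 2 * (3 / 5) * (?D X + ?D Y) + (3 / 5)\<^sup>2 * n" .
  have 3: "0 \<le> ?S W W - 2 * (29 / 100) * ?D W + (29 / 100)\<^sup>2 * n" for W
  proof -
    have "0 \<le> (\<Sum>v\<in>V. (avg W v - 29 / 100)\<^sup>2)" by (intro sum_nonneg) auto
    then show ?thesis unfolding sum_square_shift .
  qed
  have "\<tau> * n \<le> 1 / 1000 * n" using \<tau> by (intro mult_right_mono) auto
  then show False
    using 1 2 3[of X] 3[of Y] norm[OF X(1)] norm[OF X(2)] n_pos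
    unfolding power2_eq_square by argo
qed

section \<open>Vertices in blue clusters and vertices in red clusters\<close>

definition blue_part :: "'a set" where "blue_part = \<Union>blue_clusters"
definition red_part :: "'a set" where "red_part = \<Union>red_clusters"

lemma blue_cluster_sub: "blue_clusters \<subseteq> F" and red_cluster_sub: "red_clusters \<subseteq> F"
  by (auto simp: blue_clusters_def red_clusters_def)

lemma finite_blue_clusters: "finite blue_clusters"
  using finite_F blue_cluster_sub finite_subset by auto

lemma blue_part_sub: "blue_part \<subseteq> V" and red_part_sub: "red_part \<subseteq> V"
  unfolding blue_part_def red_part_def using blue_cluster_sub red_cluster_sub F(1) by blast+

lemma finite_blue_part: "finite blue_part" and finite_red_part: "finite red_part"
  using blue_part_sub red_part_sub fin finite_subset by auto

lemma parts_disjoint: "blue_part \<inter> red_part = {}"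
  unfolding blue_part_def red_part_def using blue_cluster_sub red_cluster_sub by (intro Union_clusters_disjoint) (auto simp: red_clusters_def)

lemma card_parts: "real (card blue_part) + real (card red_part) \<le> n" "n \<le> real (card blue_part) + real (card red_part) + \<tau> * n"
proof -
  have un: "blue_part \<union> red_part = \<Union>F" unfolding blue_part_def red_part_def red_clusters_def using blue_cluster_sub by blast
  have "card blue_part + card red_part = card (\<Union>F)"
    using card_Un_disjoint[OF finite_blue_part finite_red_part parts_disjoint] un by simp
  moreover have "card V = card (\<Union>F) + card (V - \<Union>F)"
    using fin un blue_part_sub red_part_sub by (metis Un_least card_Diff_subset card_mono finite_subset le_add_diff_inverse)
  ultimately show "real (card blue_part) + real (card red_part) \<le> n" "n \<le> real (card blue_part) + real (card red_part) + \<tau> * n"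
    using rest by linarith+
qed

lemma bad_sub: "bad X \<subseteq> V"
  unfolding bad_def using F(1) by blast

lemma finite_bad: "finite (bad X)"
  using bad_sub fin finite_subset by blast

lemma card_bad: "X \<in> F \<Longrightarrow> card (bad X) \<le> \<tau> * n"
  unfolding bad_def by (rule disagree)

lemma not_bad_agree: "U \<in> F \<Longrightarrow> v \<in> U \<Longrightarrow> v \<notin> bad X \<Longrightarrow> agree \<tau> X U"
  unfolding bad_def by blast

lemma avg_nonzero_linked:
  assumes "avg X v \<noteq> 0" "U \<in> F" "v \<in> U" "v \<notin> bad X"
  shows "linked X U"
proof -
  have "\<exists>x\<in>X. E x v"
  proof (rule ccontr)
    assume "\<not> ?thesis"
    then have "avg X v = 0" unfolding avg_def by (simp add: ind_def)
    then show False using assms by simp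
  qed
  then show ?thesis using assms not_bad_agree unfolding linked_def by blast
qed

text \<open>If both averages were nonzero at \<open>v\<close>, its cluster \<open>U\<close> would
  complete a linked triangle with \<open>Y\<close> and \<open>Z\<close>.\<close>

lemma linked_avg_zero:
  assumes "Y \<in> blue_clusters" "Z \<in> blue_clusters" "linked Y Z" "U \<in> blue_clusters" "v \<in> U" "v \<notin> bad Y" "v \<notin> bad Z"
  shows "avg Y v = 0 \<or> avg Z v = 0"
proof (rule ccontr)
  assume "\<not> ?thesis"
  then have "linked Y U" "linked Z U"
    using assms blue_cluster_F by (auto intro!: avg_nonzero_linked[of _ v])
  then show False using no_linked_triangle assms by blast
qed

lemma links_blue: "links Y \<subseteq> blue_clusters" and links_F: "links Y \<subseteq> F"
  using blue_cluster_sub by (auto simp: links_def)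

lemma links_disjoint: "Y \<in> blue_clusters \<Longrightarrow> Z \<in> links Y \<Longrightarrow> links Y \<inter> links Z = {}"
  unfolding links_def using no_linked_triangle by blast

lemma links_sub_blue_part: "\<Union>(links Y) \<subseteq> blue_part"
  unfolding blue_part_def using links_blue by blast

text \<open>The two norms total at most n + 2 \<tau> n; a further 3 \<tau> n pay for the two bad
  sets and the vertices outside all clusters. By \<open>linked_ge_1\<close> the terms of the first
  sum are nonnegative, so each of the two sums is bounded separately.\<close>

lemma linked_excess:
  assumes "Y \<in> blue_clusters" "Z \<in> blue_clusters" "linked Y Z"
  defines "g \<equiv> \<lambda>v. (1 - avg Y v)\<^sup>2 + (1 - avg Z v)\<^sup>2"
  shows "(\<Sum>v\<in>blue_part - bad Y - bad Z. g v - 1) + (\<Sum>v\<in>red_part. g v) \<le> card red_part + 5 * (\<tau> * n)"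
proof -
  let ?W = "blue_part - bad Y - bad Z"
  have "(\<Sum>v\<in>?W. g v) + (\<Sum>v\<in>red_part. g v) = (\<Sum>v\<in>?W \<union> red_part. g v)"
    using parts_disjoint finite_blue_part finite_red_part by (intro sum.union_disjoint[symmetric]) auto
  also have "\<dots> \<le> (\<Sum>v\<in>V. g v)"
    using fin blue_part_sub red_part_sub by (intro sum_mono2) (auto simp: g_def)
  also have "\<dots> = (\<Sum>v\<in>V. (1 - avg Y v)\<^sup>2) + (\<Sum>v\<in>V. (1 - avg Z v)\<^sup>2)"
    unfolding g_def by (rule sum.distrib)
  also have "\<dots> \<le> n + 2 * (\<tau> * n)"
    using blue_cluster_norm[OF assms(1)] blue_cluster_norm[OF assms(2)] by simp
  finally have 1: "(\<Sum>v\<in>?W. g v) + (\<Sum>v\<in>red_part. g v) \<le> n + 2 * (\<tau> * n)" .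
  have "card blue_part \<le> card (?W \<union> bad Y \<union> bad Z)"
    using finite_blue_part finite_bad by (intro card_mono) auto
  also have "\<dots> \<le> card ?W + card (bad Y) + card (bad Z)"
    by (metis (no_types, lifting) add_le_mono1 card_Un_le order_trans)
  finally have "real (card blue_part) \<le> card ?W + 2 * (\<tau> * n)"
    using card_bad[of Y] card_bad[of Z] blue_cluster_F[OF assms(1)] blue_cluster_F[OF assms(2)] by simp
  moreover have "(\<Sum>v\<in>?W. g v - 1) = (\<Sum>v\<in>?W. g v) - card ?W"
    by (simp add: sum_subtractf)
  ultimately show ?thesis using 1 card_parts by linarith
qed

lemma linked_ge_1:
  assumes "Y \<in> blue_clusters" "Z \<in> blue_clusters" "linked Y Z" "v \<in> blue_part - bad Y - bad Z"
  shows "(1 - avg Y v)\<^sup>2 + (1 - avg Z v)\<^sup>2 \<ge> 1"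
proof -
  obtain U where "U \<in> blue_clusters" "v \<in> U" using assms(4) by (auto simp: blue_part_def)
  then have "avg Y v = 0 \<or> avg Z v = 0" using assms by (intro linked_avg_zero) auto
  then show ?thesis by auto
qed

text \<open>Each zero of \<open>avg Y\<close> contributes 1 to the norm of 1 - \<open>avg Y\<close>,
  so there are at most about n/2 zeros. Every other vertex lies in a linked blue cluster, in the red
  part, in \<open>bad Y\<close>, or outside all clusters.\<close>

lemma card_links:
  assumes Y: "Y \<in> blue_clusters"
  shows "card (\<Union>(links Y)) \<ge> n / 2 - card red_part - 3 * (\<tau> * n)"
proof -
  define Z0 where "Z0 = {v\<in>V. avg Y v = 0}"
  have fins: "finite Z0" "finite (\<Union>(links Y))"
    using fin finite_subset[OF links_sub_blue_part finite_blue_part] by (auto simp: Z0_def)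
  have "real (card Z0) = (\<Sum>v\<in>Z0. (1 - avg Y v)\<^sup>2)" by (simp add: Z0_def)
  also have "\<dots> \<le> (\<Sum>v\<in>V. (1 - avg Y v)\<^sup>2)" using fin by (intro sum_mono2) (auto simp: Z0_def)
  finally have 1: "real (card Z0) \<le> n / 2 + \<tau> * n" using blue_cluster_norm[OF Y] by simp
  have "V \<subseteq> Z0 \<union> red_part \<union> (V - \<Union>F) \<union> bad Y \<union> \<Union>(links Y)"
  proof
    fix v assume "v \<in> V"
    show "v \<in> Z0 \<union> red_part \<union> (V - \<Union>F) \<union> bad Y \<union> \<Union>(links Y)"
    proof (rule ccontr)
      assume *: "\<not> ?thesis"
      then obtain U where U: "U \<in> F" "v \<in> U" using \<open>v \<in> V\<close> by blast
      then have "U \<in> blue_clusters" using * by (auto simp: red_part_def red_clusters_def)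
      moreover have "linked Y U"
        using * U \<open>v \<in> V\<close> by (intro avg_nonzero_linked[of _ v]) (auto simp: Z0_def)
      ultimately have "U \<in> links Y" by (simp add: links_def)
      then show False using * U by blast
    qed
  qed
  then have "card V \<le> card (Z0 \<union> red_part \<union> (V - \<Union>F) \<union> bad Y \<union> \<Union>(links Y))"
    using fins fin finite_red_part finite_bad by (intro card_mono) auto
  also have "\<dots> \<le> card Z0 + card red_part + card (V - \<Union>F) + card (bad Y) + card (\<Union>(links Y))"
    by (meson add_le_mono1 card_Un_le order_trans)
  finally show ?thesis using 1 rest card_bad[OF blue_cluster_F[OF Y]] by linarith
qed

text \<open>\<open>X\<close> is completely red to almost the whole red part, where
  \<open>avg X\<close> is then 1. This uses up about \<open>card red_part\<close> of the norm bound
  n/12.\<close>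

lemma red_cluster_row:
  assumes X: "X \<in> red_clusters"
  shows "(\<Sum>v\<in>blue_part. (avg X v)\<^sup>2) \<le> n / 12 + 3 * (\<tau> * n) - card red_part"
proof -
  let ?W = "red_part - bad X - X"
  have one: "avg X v = 1" if v: "v \<in> ?W" for v
  proof -
    obtain U where U: "U \<in> red_clusters" "v \<in> U" using v by (auto simp: red_part_def)
    then have "agree \<tau> X U" using v not_bad_agree red_cluster_F by blast
    moreover have "X \<noteq> U" using U v by auto
    ultimately have "E x v" if "x \<in> X" for x using red_cluster_complete[OF X U(1) _ _ that U(2)] by blast
    then show ?thesis using F(2)[OF red_cluster_F[OF X]] m(1) by (simp add: avg_def ind_def)
  qed
  have "card red_part \<le> card (?W \<union> bad X \<union> X)"
    using finite_red_part finite_bad F_finite[OF red_cluster_F[OF X]] by (intro card_mono) auto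
  also have "\<dots> \<le> card ?W + card (bad X) + card X"
    by (metis (no_types, lifting) add_le_mono1 card_Un_le order_trans)
  finally have c: "real (card red_part) \<le> card ?W + 2 * (\<tau> * n)"
    using card_bad[OF red_cluster_F[OF X]] F(2)[OF red_cluster_F[OF X]] m(3) by simp
  have "(\<Sum>v\<in>blue_part. (avg X v)\<^sup>2) + card ?W = (\<Sum>v\<in>blue_part. (avg X v)\<^sup>2) + (\<Sum>v\<in>?W. (avg X v)\<^sup>2)"
    using one by simp
  also have "\<dots> = (\<Sum>v\<in>blue_part \<union> ?W. (avg X v)\<^sup>2)"
    using parts_disjoint finite_blue_part finite_red_part by (intro sum.union_disjoint[symmetric]) auto
  also have "\<dots> \<le> (\<Sum>v\<in>V. (avg X v)\<^sup>2)"
    using fin blue_part_sub red_part_sub by (intro sum_mono2) auto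
  finally show ?thesis using c red_cluster_norm[OF X] by linarith
qed

section \<open>Few vertices in red clusters: counting red edges between the two parts\<close>

lemma m_avg: "real m * avg X v = (\<Sum>x\<in>X. ind x v)"
  using m(1) by (simp add: avg_def)

definition mass :: "'a set \<Rightarrow> real" where "mass U = (\<Sum>v\<in>red_part. avg U v)"

lemma mass_nonneg: "mass U \<ge> 0"
  unfolding mass_def by (intro sum_nonneg avg_nonneg)

text \<open>With little mass, the two squares would add up to nearly 2 on the red part, against
  \<open>linked_excess\<close>. The square is replaced by its tangent at 3/10, near the point 1 -
  1/sqrt(2) where two equal squares add up to 1.\<close>

lemma linked_mass:
  assumes "Y \<in> blue_clusters" "Z \<in> blue_clusters" "linked Y Z"
  shows "7 / 5 * (mass Y + mass Z) \<ge> 41 / 50 * card red_part - 5 * (\<tau> * n)"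
proof -
  define g where "g v = (1 - avg Y v)\<^sup>2 + (1 - avg Z v)\<^sup>2" for v
  have tangent: "(1 - t)\<^sup>2 \<ge> 91 / 100 - 7 / 5 * t" for t :: real
  proof -
    have "(1 - t)\<^sup>2 - (91 / 100 - 7 / 5 * t) = (t - 3 / 10)\<^sup>2"
      by (simp add: power2_eq_square field_simps)
    then show ?thesis by (metis diff_ge_0_iff_ge zero_le_power2)
  qed
  have "0 \<le> (\<Sum>v\<in>blue_part - bad Y - bad Z. g v - 1)"
    using linked_ge_1[OF assms] unfolding g_def by (intro sum_nonneg) fastforce
  then have "(\<Sum>v\<in>red_part. g v) \<le> card red_part + 5 * (\<tau> * n)"
    using linked_excess[OF assms] unfolding g_def by linarith
  moreover have "(\<Sum>v\<in>red_part. (91 / 100 - 7 / 5 * avg Y v) + (91 / 100 - 7 / 5 * avg Z v)) \<le> (\<Sum>v\<in>red_part. g v)"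
    unfolding g_def by (intro sum_mono add_mono tangent)
  moreover have "(\<Sum>v\<in>red_part. (91 / 100 - 7 / 5 * avg Y v) + (91 / 100 - 7 / 5 * avg Z v))
      = 91 / 50 * card red_part - 7 / 5 * (mass Y + mass Z)"
    unfolding mass_def sum.distrib sum_subtractf sum_distrib_left[symmetric] by (simp add: field_simps)
  ultimately show ?thesis by linarith
qed

end

text \<open>Here \<open>l\<close> is the density of the red part and \<open>t\<close> is \<tau>. The
  linear coefficients are close, 123/700 on the left and 13/75 on the right, but their gap outweighs
  the terms in \<open>t\<close> because t \<le> l/10000, and the terms in l^2 help as well.\<close>

lemma density_contradiction:
  fixes l t :: real
  assumes "1 / 10 ^ 9 \<le> l" "l \<le> 1 / 10" "0 < t" "t \<le> 1 / 10 ^ 13"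
    and le: "3 / 5 * ((1 / 2 - l - 3 * t) * ((41 / 50 * l - 5 * t) * (5 / 7)))
      \<le> l * (9 / 100 * (1 - l) + 1 / 12 + 3 * t - l)"
  shows False
proof -
  have tl: "t * 10000 \<le> l" using assms by simp
  have "3 / 5 * ((1 / 2 - l - 3 * t) * ((41 / 50 * l - 5 * t) * (5 / 7)))
      = 123 / 700 * l - 15 / 14 * t - 123 / 350 * (l * l) + 381 / 350 * (t * l) + 45 / 7 * (t * t)"
    by (simp add: field_simps)
  moreover have "l * (9 / 100 * (1 - l) + 1 / 12 + 3 * t - l)
      = 13 / 75 * l - 109 / 100 * (l * l) + 3 * (t * l)"
    by (simp add: field_simps)
  moreover have "0 \<le> t * l" "t * l \<le> t * (1 / 10)" "0 \<le> l * l" "0 \<le> t * t"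
    using assms by (auto intro: mult_left_mono)
  moreover have "0 < l" using assms(1) by (rule order_less_le_trans[rotated]) simp
  ultimately show False using le tl by argo
qed

context clustered
begin

abbreviation cross :: real where "cross \<equiv> \<Sum>x\<in>red_part. \<Sum>u\<in>blue_part. ind x u"

text \<open>Counting from the red side: \<open>red_cluster_row\<close> bounds the squares in each
  row, and the tangent of the square at 3/10, near 1/sqrt(12), makes this a bound on the row
  sum.\<close>

lemma cross_le:
  "3 / 5 * cross \<le> card red_part * (9 / 100 * (n - card red_part) + n / 12 + 3 * (\<tau> * n) - card red_part)"
proof -
  let ?C = "9 / 100 * (n - card red_part) + n / 12 + 3 * (\<tau> * n) - card red_part"
  have row: "3 / 5 * (\<Sum>u\<in>blue_part. avg X u) \<le> ?C" if "X \<in> red_clusters" for X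
  proof -
    have tangent: "3 / 5 * t \<le> t\<^sup>2 + 9 / 100" for t :: real
    proof -
      have "t\<^sup>2 + 9 / 100 - 3 / 5 * t = (t - 3 / 10)\<^sup>2"
        by (simp add: power2_eq_square field_simps)
      then show ?thesis by (metis diff_ge_0_iff_ge zero_le_power2)
    qed
    have "3 / 5 * (\<Sum>u\<in>blue_part. avg X u) \<le> (\<Sum>u\<in>blue_part. (avg X u)\<^sup>2 + 9 / 100)"
      unfolding sum_distrib_left by (intro sum_mono tangent)
    also have "\<dots> = (\<Sum>u\<in>blue_part. (avg X u)\<^sup>2) + 9 / 100 * card blue_part" by (simp add: sum.distrib)
    finally show ?thesis using red_cluster_row[OF that] card_parts(1) by argo
  qed
  have "cross = (\<Sum>X\<in>red_clusters. \<Sum>x\<in>X. \<Sum>u\<in>blue_part. ind x u)"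
    unfolding red_part_def using red_cluster_sub by (rule sum_Union)
  also have "\<dots> = (\<Sum>X\<in>red_clusters. \<Sum>u\<in>blue_part. real m * avg X u)"
    unfolding m_avg by (intro sum.cong refl sum.swap)
  also have "\<dots> = (\<Sum>X\<in>red_clusters. real m * (\<Sum>u\<in>blue_part. avg X u))"
    by (simp only: sum_distrib_left)
  finally have eq: "cross = (\<Sum>X\<in>red_clusters. real m * (\<Sum>u\<in>blue_part. avg X u))" .
  have "3 / 5 * cross = (\<Sum>X\<in>red_clusters. real m * (3 / 5 * (\<Sum>u\<in>blue_part. avg X u)))"
    unfolding eq by (subst sum_distrib_left) (simp only: mult.left_commute)
  also have "\<dots> \<le> (\<Sum>X\<in>red_clusters. real m * ?C)" using row by (intro sum_mono mult_left_mono) auto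
  also have "\<dots> = (real m * card red_clusters) * ?C" by simp
  also have "real m * card red_clusters = card red_part" unfolding red_part_def using card_Union[OF red_cluster_sub] by simp
  finally show ?thesis .
qed

text \<open>Counting from the blue side: each blue cluster \<open>U\<close> contributes
  \<open>m\<close> times \<open>mass U\<close>.\<close>

lemma cross_ge:
  fixes a b :: real
  assumes "A \<subseteq> blue_clusters" "B \<subseteq> blue_clusters" "A \<inter> B = {}" "\<And>U. U \<in> A \<Longrightarrow> a \<le> mass U" "\<And>U. U \<in> B \<Longrightarrow> b \<le> mass U"
  shows "card (\<Union>A) * a + card (\<Union>B) * b \<le> cross"
proof -
  have lower: "card (\<Union>A) * a \<le> (\<Sum>U\<in>A. real m * mass U)" if "A \<subseteq> blue_clusters" "\<And>U. U \<in> A \<Longrightarrow> a \<le> mass U" for A and a :: real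
  proof -
    have "card (\<Union>A) * a = (\<Sum>U\<in>A. real m * a)" using card_Union[of A] that blue_cluster_sub by simp
    also have "\<dots> \<le> (\<Sum>U\<in>A. real m * mass U)" using that by (intro sum_mono mult_left_mono) auto
    finally show ?thesis .
  qed
  have "card (\<Union>A) * a + card (\<Union>B) * b \<le> (\<Sum>U\<in>A. real m * mass U) + (\<Sum>U\<in>B. real m * mass U)"
    using assms by (intro add_mono lower) auto
  also have "\<dots> = (\<Sum>U\<in>A \<union> B. real m * mass U)"
    using assms finite_blue_clusters finite_subset by (intro sum.union_disjoint[symmetric]) auto
  also have "\<dots> \<le> (\<Sum>U\<in>blue_clusters. real m * mass U)"
    using assms finite_blue_clusters mass_nonneg by (intro sum_mono2) auto
  also have "\<dots> = (\<Sum>U\<in>blue_clusters. \<Sum>v\<in>red_part. \<Sum>u\<in>U. ind u v)"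
    by (simp only: mass_def sum_distrib_left m_avg)
  also have "\<dots> = (\<Sum>U\<in>blue_clusters. \<Sum>u\<in>U. \<Sum>v\<in>red_part. ind u v)"
    by (intro sum.cong refl sum.swap)
  also have "\<dots> = (\<Sum>u\<in>blue_part. \<Sum>v\<in>red_part. ind u v)"
    unfolding blue_part_def using blue_cluster_sub by (rule sum_Union[symmetric])
  also have "\<dots> = cross"
    by (subst sum.swap) (simp add: ind_sym)
  finally show ?thesis .
qed

lemma tau_n_le: "\<tau> * n \<le> n / 10 ^ 13"
  using mult_right_mono[OF \<tau>(3), of n] by simp

text \<open>Take \<open>Y\<close> of least mass and \<open>Z\<close> of least mass in
  \<open>links Y\<close>. Clusters in \<open>links Y\<close> have mass at least
  \<open>mass Z\<close>, those in the disjoint family \<open>links Z\<close> at least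
  \<open>mass Y\<close>, so \<open>cross\<close> is at least about n/2 -
  \<open>card red_part\<close> times \<open>mass Y + mass Z\<close>. With \<open>linked_mass\<close>
  this contradicts \<open>cross_le\<close> unless the red part is tiny.\<close>

lemma few_red_cluster_vertices: "card red_part < n / 10 ^ 9"
proof (rule ccontr)
  assume "\<not> ?thesis"
  then have big: "card red_part \<ge> n / 10 ^ 9" by simp
  have tn: "\<tau> * n \<le> n / 1000" "0 < \<tau> * n" using tau_n_le n_pos \<tau>(2) by auto
  have "red_clusters \<noteq> {}"
  proof
    assume "red_clusters = {}"
    then have "card red_part = 0" by (simp add: red_part_def)
    then show False using big n_pos by simp
  qed
  then obtain X where X: "X \<in> red_clusters" by blast
  \<comment> \<open>The norm left over in \<open>red_cluster_row\<close> is nonnegative, so the red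
    part has at most about n/12 vertices to begin with.\<close>
  have "0 \<le> (\<Sum>v\<in>blue_part. (avg X v)\<^sup>2)" by (intro sum_nonneg) auto
  then have small: "card red_part \<le> n / 10" using red_cluster_row[OF X] tn by argo
  have "blue_clusters \<noteq> {}"
  proof
    assume "blue_clusters = {}"
    then have "real (card blue_part) = 0" by (simp add: blue_part_def)
    then show False using card_parts(2) small tn n_pos by argo
  qed
  then obtain Y where Y: "Y \<in> blue_clusters" "\<And>U. U \<in> blue_clusters \<Longrightarrow> mass Y \<le> mass U"
    using arg_min_if_finite(1)[OF finite_blue_clusters, of mass] arg_min_least[OF finite_blue_clusters, of _ mass] by metis
  have links_ne: "links Y \<noteq> {}"
  proof
    assume "links Y = {}"
    then have "real (card (\<Union>(links Y))) = 0" by simp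
    then show False using card_links[OF Y(1)] small tn n_pos by argo
  qed
  have "finite (links Y)" using links_blue finite_blue_clusters finite_subset by blast
  then obtain Z where Z: "Z \<in> links Y" "\<And>U. U \<in> links Y \<Longrightarrow> mass Z \<le> mass U"
    using links_ne arg_min_if_finite(1)[of "links Y" mass] arg_min_least[of "links Y" _ mass] by metis
  have ZH: "Z \<in> blue_clusters" "linked Y Z" using Z by (auto simp: links_def)
  let ?s = "n / 2 - card red_part - 3 * (\<tau> * n)"
  have s: "?s \<ge> 0" using small tn n_pos by argo
  have "?s * ((41 / 50 * card red_part - 5 * (\<tau> * n)) * (5 / 7)) \<le> ?s * (mass Y + mass Z)"
    using linked_mass[OF Y(1) ZH] by (intro mult_left_mono s) argo
  also have "\<dots> = ?s * mass Z + ?s * mass Y" by (simp add: distrib_left)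
  also have "\<dots> \<le> card (\<Union>(links Y)) * mass Z + card (\<Union>(links Z)) * mass Y"
    using card_links Y ZH mass_nonneg by (intro add_mono mult_right_mono) auto
  also have "\<dots> \<le> cross"
    using Y Z links_blue links_disjoint[OF Y(1) Z(1)] by (intro cross_ge) blast+
  finally have le: "3 / 5 * (?s * ((41 / 50 * card red_part - 5 * (\<tau> * n)) * (5 / 7)))
    \<le> card red_part * (9 / 100 * (n - card red_part) + n / 12 + 3 * (\<tau> * n) - card red_part)"
    using cross_le by argo
  define l where "l = card red_part / n"
  have L: "real (card red_part) = l * n" using n_pos by (simp add: l_def)
  have scale: "?s = (1 / 2 - l - 3 * \<tau>) * n"
    "41 / 50 * card red_part - 5 * (\<tau> * n) = (41 / 50 * l - 5 * \<tau>) * n"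
    "9 / 100 * (n - card red_part) + n / 12 + 3 * (\<tau> * n) - card red_part
      = (9 / 100 * (1 - l) + 1 / 12 + 3 * \<tau> - l) * n"
    unfolding L by (simp_all add: field_simps)
  have "(3 / 5 * ((1 / 2 - l - 3 * \<tau>) * ((41 / 50 * l - 5 * \<tau>) * (5 / 7)))) * n\<^sup>2
      \<le> (l * (9 / 100 * (1 - l) + 1 / 12 + 3 * \<tau> - l)) * n\<^sup>2"
    using le unfolding scale unfolding L power2_eq_square by (simp only: mult_ac)
  then have "3 / 5 * ((1 / 2 - l - 3 * \<tau>) * ((41 / 50 * l - 5 * \<tau>) * (5 / 7)))
      \<le> l * (9 / 100 * (1 - l) + 1 / 12 + 3 * \<tau> - l)"
    by (rule mult_right_le_imp_le) (use n_pos in simp)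
  moreover have "1 / 10 ^ 9 \<le> l" "l \<le> 1 / 10"
    using big small n_pos by (simp_all add: l_def field_simps)
  ultimately show False using density_contradiction[of l \<tau>] \<tau> by blast
qed

section \<open>A nearly complete bipartite pair from linked clusters\<close>

text \<open>Outside the bad sets, \<open>avg Y\<close> vanishes on \<open>links Z\<close>, since
  otherwise \<open>Y\<close>, \<open>Z\<close> and the cluster there form a linked triangle. So the
  square of 1 - \<open>avg U\<close> is exactly the excess over 1 in \<open>linked_excess\<close>
  for \<open>Y\<close> and \<open>U\<close>, which is tiny because the red part is.\<close>

lemma misses_le:
  assumes Y: "Y \<in> blue_clusters" and Z: "Z \<in> links Y" and U: "U \<in> links Y"
  shows "(\<Sum>v\<in>\<Union>(links Z). 1 - avg U v) \<le> n / 10000"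
proof -
  let ?B = "\<Union>(links Z)" and ?W = "blue_part - bad Y - bad U"
  have ZH: "Z \<in> blue_clusters" "linked Y Z" and UH: "U \<in> blue_clusters" "linked Y U" using Z U by (auto simp: links_def)
  have finB: "finite ?B" using finite_subset[OF links_sub_blue_part finite_blue_part] .
  have zero: "avg Y v = 0" if v: "v \<in> ?B \<inter> ?W" for v
  proof (rule ccontr)
    assume nz: "avg Y v \<noteq> 0"
    obtain T where T: "T \<in> blue_clusters" "linked Z T" "v \<in> T" using v by (auto simp: links_def)
    then have "linked Y T" using nz v blue_cluster_F by (intro avg_nonzero_linked[of _ v]) auto
    then show False using no_linked_triangle[OF Y ZH(1) T(1)] ZH T by blast
  qed
  have "(\<Sum>v\<in>?B \<inter> ?W. (1 - avg U v)\<^sup>2) = (\<Sum>v\<in>?B \<inter> ?W. (1 - avg Y v)\<^sup>2 + (1 - avg U v)\<^sup>2 - 1)"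
    using zero by (intro sum.cong) auto
  also have "\<dots> \<le> (\<Sum>v\<in>?W. (1 - avg Y v)\<^sup>2 + (1 - avg U v)\<^sup>2 - 1)"
    using linked_ge_1[OF Y UH] finite_blue_part by (intro sum_mono2) auto
  also have "\<dots> \<le> card red_part + 5 * (\<tau> * n)"
  proof -
    have "0 \<le> (\<Sum>v\<in>red_part. (1 - avg Y v)\<^sup>2 + (1 - avg U v)\<^sup>2)" by (intro sum_nonneg) auto
    then show ?thesis using linked_excess[OF Y UH] by argo
  qed
  finally have 1: "(\<Sum>v\<in>?B \<inter> ?W. (1 - avg U v)\<^sup>2) \<le> card red_part + 5 * (\<tau> * n)" .
  have "(\<Sum>v\<in>?B - ?W. (1 - avg U v)\<^sup>2) \<le> (\<Sum>v\<in>?B - ?W. 1)"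
    using avg_nonneg avg_le_1 blue_cluster_F[OF UH(1)] by (intro sum_mono power_le_one) auto
  also have "\<dots> = card (?B - ?W)" by simp
  also have "\<dots> \<le> card (bad Y \<union> bad U)"
    using links_sub_blue_part finite_bad by (intro of_nat_mono card_mono) auto
  also have "\<dots> \<le> card (bad Y) + card (bad U)" by (intro of_nat_mono card_Un_le)
  also have "\<dots> \<le> 2 * (\<tau> * n)" using card_bad[OF blue_cluster_F[OF Y]] card_bad[OF blue_cluster_F[OF UH(1)]] by simp
  finally have 2: "(\<Sum>v\<in>?B - ?W. (1 - avg U v)\<^sup>2) \<le> 2 * (\<tau> * n)" .
  have sq: "(\<Sum>v\<in>?B. (1 - avg U v)\<^sup>2) \<le> 2 * (n / 10 ^ 9)"
  proof -
    have "7 * \<tau> \<le> 1 / 10 ^ 9" using \<tau>(3) by simp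
    then have "7 * \<tau> * n \<le> 1 / 10 ^ 9 * n" by (intro mult_right_mono) auto
    moreover define e where "e = n / 10 ^ 9"
    ultimately have "7 * (\<tau> * n) \<le> e" by simp
    moreover have "card red_part < e" using few_red_cluster_vertices by (simp add: e_def)
    ultimately show ?thesis unfolding e_def[symmetric]
      using 1 2 sum.Int_Diff[OF finB, of "\<lambda>v. (1 - avg U v)\<^sup>2" ?W] by linarith
  qed
  \<comment> \<open>From squares to first powers, by expanding 5000 (t - 1/10000)^2 \<ge> 0. The
    constants cost at most n/20000 in total and the squares n/100000.\<close>
  have "t \<le> 1 / 20000 + 5000 * t\<^sup>2" for t :: real
  proof -
    have "0 \<le> 5000 * (t - 1 / 10000)\<^sup>2" by simp
    then show ?thesis by (simp add: power2_eq_square algebra_simps)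
  qed
  then have "(\<Sum>v\<in>?B. 1 - avg U v) \<le> (\<Sum>v\<in>?B. 1 / 20000 + 5000 * (1 - avg U v)\<^sup>2)"
    by (intro sum_mono) auto
  also have "\<dots> = card ?B / 20000 + 5000 * (\<Sum>v\<in>?B. (1 - avg U v)\<^sup>2)"
    by (simp add: sum.distrib sum_distrib_left)
  also have "\<dots> \<le> n / 20000 + 5000 * (2 * (n / 10 ^ 9))"
  proof -
    have "card ?B \<le> card V" using links_sub_blue_part blue_part_sub fin by (intro card_mono) auto
    then show ?thesis using sq by (intro add_mono mult_left_mono) auto
  qed
  also have "\<dots> \<le> n / 10000" by simp
  finally show ?thesis .
qed

text \<open>For linked blue clusters \<open>Y\<close> and \<open>Z\<close>, the unions of
  \<open>links Y\<close> and \<open>links Z\<close> each hold at least 9/20 of the vertices, and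
  summing \<open>misses_le\<close> over \<open>links Y\<close> shows that few red edges between them
  are missing.\<close>

lemma contradiction: False
proof -
  have tn: "\<tau> * n \<le> n / 1000" "0 < \<tau> * n" using tau_n_le n_pos \<tau>(2) by auto
  have small: "card red_part \<le> n / 1000" using few_red_cluster_vertices n_pos by simp
  have "blue_clusters \<noteq> {}"
  proof
    assume "blue_clusters = {}"
    then have "real (card blue_part) = 0" by (simp add: blue_part_def)
    then show False using card_parts(2) small tn n_pos by argo
  qed
  then obtain Y where Y: "Y \<in> blue_clusters" by blast
  have half: "9 / 20 * n \<le> card (\<Union>(links U))" if "U \<in> blue_clusters" for U
    using card_links[OF that] small tn n_pos by argo
  have "links Y \<noteq> {}" using half[OF Y] n_pos by auto
  then obtain Z where Z: "Z \<in> links Y" by blast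
  then have ZH: "Z \<in> blue_clusters" by (auto simp: links_def)
  have sub: "\<Union>(links U) \<subseteq> V" for U using links_sub_blue_part blue_part_sub by blast
  let ?B = "\<Union>(links Z)"
  have "(\<Sum>a\<in>\<Union>(links Y). \<Sum>b\<in>?B. 1 - ind a b) = (\<Sum>U\<in>links Y. \<Sum>a\<in>U. \<Sum>b\<in>?B. 1 - ind a b)"
    using links_F by (rule sum_Union)
  also have "\<dots> = (\<Sum>U\<in>links Y. \<Sum>b\<in>?B. \<Sum>a\<in>U. 1 - ind a b)"
    by (intro sum.cong refl sum.swap)
  also have "\<dots> = (\<Sum>U\<in>links Y. \<Sum>b\<in>?B. real m * (1 - avg U b))"
    using links_F m(1) by (intro sum.cong refl) (auto simp: one_minus_avg subset_iff)
  also have "\<dots> = (\<Sum>U\<in>links Y. real m * (\<Sum>b\<in>?B. 1 - avg U b))"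
    by (simp only: sum_distrib_left)
  also have "\<dots> \<le> (\<Sum>U\<in>links Y. real m * (n / 10000))"
    using misses_le[OF Y Z] by (intro sum_mono mult_left_mono) auto
  also have "\<dots> = card (\<Union>(links Y)) * (n / 10000)" using card_Union[OF links_F] by simp
  also have "\<dots> \<le> n * (n / 10000)"
    using card_mono[OF fin sub] by (intro mult_right_mono) auto
  finally have miss: "(\<Sum>a\<in>\<Union>(links Y). \<Sum>b\<in>?B. 1 - ind a b) \<le> n\<^sup>2 / 10000"
    by (simp add: power2_eq_square)
  have "1 \<le> real m" using m(1) by simp
  then have "100 \<le> n" using m(3) tn by argo
  then show False
    using no_dense_bipartite_pair[OF sub half[OF Y] sub half[OF ZH] miss] by simp
qed

end

subsection \<open>Ramsey numbers of books\<close>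

lemma no_large_book_avoiding:
  fixes \<epsilon> :: real
  assumes "\<epsilon> > 0"
  shows "\<exists>n\<^sub>0. \<forall>(V :: 'a set) E. card V \<ge> n\<^sub>0 \<longrightarrow> \<not> book_avoiding V E (1 / 12 - \<epsilon>)"
proof -
  \<comment> \<open>The bound \<epsilon>/3 gives 6 (1/12 - \<epsilon>) + 9 \<tau> \<le> 1/2 - 3
    \<epsilon>.\<close>
  define \<tau> where "\<tau> = min (1 / 10 ^ 13) (\<epsilon> / 3)"
  define m where "m = nat \<lceil>1 / \<tau>\<rceil>"
  have \<tau>: "0 < \<tau>" "\<tau> \<le> 1 / 10 ^ 13" "\<tau> \<le> \<epsilon> / 3" using assms by (auto simp: \<tau>_def)
  have \<tau>1: "\<tau> \<le> 1" by (rule order_trans[OF \<tau>(2)]) simp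
  have m\<tau>: "1 / \<tau> \<le> m" unfolding m_def by linarith
  have "1 \<le> 1 / \<tau>" using \<tau> \<tau>1 by simp
  then have m1: "m \<ge> 1" using m\<tau> by linarith
  have m\<tau>': "1 / m \<le> \<tau>" using m\<tau> \<tau> m1 by (simp add: field_simps)
  obtain n1 where n1: "\<forall>(V :: 'a set) E. finite_graph V E \<and> card V \<ge> n1 \<longrightarrow>
    (\<exists>F. (\<forall>X\<in>F. X \<subseteq> V \<and> card X = m \<and> finite_graph.homogeneous E X) \<and> pairwise disjnt F \<and>
      card (V - \<Union>F) \<le> \<tau> * card V \<and>
      (\<forall>X\<in>F. card (\<Union>{Y\<in>F. \<not> finite_graph.agree V E \<tau> X Y}) \<le> \<tau> * card V))"
    using cluster_family[OF \<tau>(1) \<tau>1 m1] ..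
  show ?thesis
  proof (intro exI[of _ "max n1 (nat \<lceil>m / \<tau>\<rceil>)"] allI impI notI)
    fix V :: "'a set" and E
    assume n: "max n1 (nat \<lceil>m / \<tau>\<rceil>) \<le> card V" and "book_avoiding V E (1 / 12 - \<epsilon>)"
    interpret book_avoiding V E "1 / 12 - \<epsilon>" by fact
    have "finite_graph V E \<and> card V \<ge> n1" using n finite_graph_axioms by simp
    from n1[rule_format, OF this] obtain F where
      F: "(\<forall>X\<in>F. X \<subseteq> V \<and> card X = m \<and> homogeneous X) \<and> pairwise disjnt F \<and>
        card (V - \<Union>F) \<le> \<tau> * card V \<and>
        (\<forall>X\<in>F. card (\<Union>{Y\<in>F. \<not> agree \<tau> X Y}) \<le> \<tau> * card V)" ..
    have "m / \<tau> \<le> card V" using n by linarith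
    then have "m \<le> \<tau> * card V" using \<tau> by (simp add: field_simps)
    then have "clustered V E (1 / 12 - \<epsilon>) F m \<tau>"
      using F \<tau> m1 m\<tau>' assms by unfold_locales auto
    then show False by (rule clustered.contradiction)
  qed
qed

section \<open>Books, codegrees and the extremal graph\<close>

lemma book_spine: "{0, 1} \<in> edges (book m)"
  by (simp add: book_def)

lemma book_page_edge:
  assumes "i \<in> {0, 1}" "2 \<le> j" "j < m + 2"
  shows "{i, j} \<in> edges (book m)"
proof -
  have "{i, j} \<in> {{i, j} | i j. i \<in> {0, 1} \<and> j \<in> {2..<m + 2}}"
    using assms by (intro CollectI exI[of _ i] exI[of _ j]) auto
  then show ?thesis by (simp add: book_def)
qed

lemma contains_bookI:
  assumes "{x, y} \<in> edges G" "x \<noteq> y" "x \<in> verts G" "y \<in> verts G"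
    and T: "T \<subseteq> verts G - {x, y}" "finite T" "m \<le> card T"
    and edge: "\<And>t. t \<in> T \<Longrightarrow> {x, t} \<in> edges G" "\<And>t. t \<in> T \<Longrightarrow> {y, t} \<in> edges G"
  shows "contains_subgraph G (book m)"
proof -
  obtain h where h: "bij_betw h {0..<card T} T" using ex_bij_betw_nat_finite[OF T(2)] by blast
  have hT: "h i \<in> T" if "i < m" for i using h that T(3) by (auto simp: bij_betw_def)
  have hinj: "h i = h j \<longleftrightarrow> i = j" if "i < m" "j < m" for i j
    using h that T(3) by (auto simp: bij_betw_def inj_on_def)
  define f where "f i = (if i = 0 then x else if i = 1 then y else h (i - 2))" for i :: nat
  have fh: "f i = h (i - 2)" "i - 2 < m" if "2 \<le> i" "i < m + 2" for i
    using that by (auto simp: f_def)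
  have "inj_on f {..<m + 2}"
  proof (rule inj_onI)
    fix i j assume ij: "i \<in> {..<m + 2}" "j \<in> {..<m + 2}" "f i = f j"
    have ne: "f k \<noteq> x" "f k \<noteq> y" if "2 \<le> k" "k < m + 2" for k
      using fh[OF that] hT[of "k - 2"] T(1) by auto
    consider "i < 2" "j < 2" | "i < 2" "2 \<le> j" | "2 \<le> i" "j < 2" | "2 \<le> i" "2 \<le> j" by linarith
    then show "i = j"
    proof cases
      case 1
      then show ?thesis using ij assms(2) by (auto simp: f_def less_2_cases_iff)
    next
      case 2
      then show ?thesis using ij ne[of j] by (auto simp: less_2_cases_iff f_def)
    next
      case 3
      then show ?thesis using ij ne[of i] by (auto simp: less_2_cases_iff f_def)
    next
      case 4
      then have "h (i - 2) = h (j - 2)" "i - 2 < m" "j - 2 < m" using ij fh by auto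
      then have "i - 2 = j - 2" using hinj by blast
      then show ?thesis using 4 by linarith
    qed
  qed
  moreover have "f i \<in> verts G" if "i < m + 2" for i
  proof (cases "i < 2")
    case True
    then show ?thesis using assms(3,4) by (auto simp: f_def)
  next
    case False
    then have "f i = h (i - 2)" "i - 2 < m" using fh[of i] that by auto
    then show ?thesis using hT[of "i - 2"] T(1) by auto
  qed
  moreover have "f ` e \<in> edges G" if "e \<in> edges (book m)" for e
  proof -
    from that consider "e = {0, 1}" | i j where "e = {i, j}" "i \<in> {0, 1}" "j \<in> {2..<m + 2}"
      by (auto simp: book_def)
    then show ?thesis
    proof cases
      case 1
      then show ?thesis using assms(1) by (simp add: f_def insert_commute)
    next
      case 2
      then have "f ` e = {f i, f j}" "f i = x \<or> f i = y" "f j \<in> T"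
        using hT[of "j - 2"] fh[of j] by (auto simp: f_def)
      then show ?thesis using edge by auto
    qed
  qed
  ultimately show ?thesis
    unfolding contains_subgraph_def by (intro exI[of _ f]) (auto simp: book_def)
qed

lemma mem_edges_complement:
  "{x, y} \<in> edges (complement G) \<longleftrightarrow> x \<in> verts G \<and> y \<in> verts G \<and> x \<noteq> y \<and> {x, y} \<notin> edges G"
  by (auto simp: complement_def nsets_def card_insert_if)

lemma book_avoiding_if_no_books:
  fixes \<beta> :: real
  assumes G: "simple_graph G" and card: "card (verts G) = 2 * q + 3"
    and p: "real p \<le> \<beta> * card (verts G)" and "\<beta> \<le> 1 / 12"
    and no: "\<not> contains_subgraph G (book p)" "\<not> contains_subgraph (complement G) (book q)"
  shows "book_avoiding (verts G) (\<lambda>x y. {x, y} \<in> edges G) \<beta>"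
proof -
  let ?E = "\<lambda>x y. {x, y} \<in> edges G"
  have fin: "finite (verts G)" and edge: "\<And>x y. ?E x y \<Longrightarrow> x \<in> verts G \<and> y \<in> verts G \<and> x \<noteq> y"
    using G by (auto simp: simple_graph_def nsets_def card_insert_if split: if_splits)
  interpret finite_graph "verts G" ?E
  proof
    show "finite (verts G)" by (rule fin)
    show "{y, x} \<in> edges G" if "{x, y} \<in> edges G" for x y using that by (simp add: insert_commute)
    show "{x, x} \<notin> edges G" for x using edge[of x x] by blast
  qed
  show ?thesis
  proof unfold_locales
    fix x y assume xy: "x \<in> verts G" "y \<in> verts G" "?E x y"
    let ?T = "{v\<in>verts G. ?E x v \<and> ?E y v}"
    have "card ?T < p"
    proof (rule ccontr)
      assume "\<not> ?thesis"
      then have "contains_subgraph G (book p)"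
        using xy edge fin by (intro contains_bookI[of x y G ?T]) auto
      then show False using no by simp
    qed
    then show "cod x y \<le> \<beta> * card (verts G)" using p by (simp add: cod_eq_card)
  next
    fix x y assume xy: "x \<in> verts G" "y \<in> verts G" "x \<noteq> y" "\<not> ?E x y"
    let ?T = "{v\<in>verts G. \<not> ?E x v \<and> \<not> ?E y v}"
    have "card (?T - {x, y}) < q"
    proof (rule ccontr)
      assume "\<not> ?thesis"
      then have "contains_subgraph (complement G) (book q)"
        using xy fin by (intro contains_bookI[of x y _ "?T - {x, y}"])
          (auto simp: mem_edges_complement, auto simp: complement_def)
      then show False using no by simp
    qed
    \<comment> \<open>The non-adjacent vertices \<open>x\<close> and \<open>y\<close> themselves
      belong to \<open>?T\<close>, so \<open>ccod x y\<close> is at most (q - 1) + 2, half of |V| -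
      1.\<close>
    moreover have "card ?T \<le> card (?T - {x, y}) + 2"
    proof -
      have "card ?T \<le> card ((?T - {x, y}) \<union> {x, y})" using fin by (intro card_mono) auto
      also have "\<dots> \<le> card (?T - {x, y}) + card {x, y}" by (rule card_Un_le)
      finally show ?thesis using xy by simp
    qed
    ultimately show "2 * ccod x y \<le> real (card (verts G)) - 1"
      unfolding ccod_eq_card card by linarith
  qed fact
qed

text \<open>The complete bipartite graph between the first \<open>q + 1\<close> vertices and the
  rest has no triangle. Its complement splits into two cliques of at most \<open>q + 1\<close>
  vertices, too small for the \<open>q + 2\<close> vertices of a book.\<close>

lemma complete_bipartite_no_books:
  assumes "p \<ge> 1" "N \<le> 2 * q + 2"
  shows "\<exists>G :: nat graph. simple_graph G \<and> card (verts G) = N \<and>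
    \<not> contains_subgraph G (book p) \<and> \<not> contains_subgraph (complement G) (book q)"
proof -
  define E where "E = {{i, j} | i j. (i < q + 1 \<longleftrightarrow> \<not> j < q + 1) \<and> i < N \<and> j < N}"
  define G :: "nat graph" where "G = ({..<N}, E)"
  have E: "{i, j} \<in> E \<longleftrightarrow> (i < q + 1 \<longleftrightarrow> \<not> j < q + 1) \<and> i < N \<and> j < N" for i j
    unfolding E_def mem_Collect_eq doubleton_eq_iff by blast
  have "simple_graph G"
    by (auto simp: simple_graph_def G_def E_def nsets_def card_insert_if)
  moreover have "\<not> contains_subgraph G (book p)"
  proof
    assume "contains_subgraph G (book p)"
    then obtain f where f: "\<And>e. e \<in> edges (book p) \<Longrightarrow> f ` e \<in> E"
      by (auto simp: contains_subgraph_def G_def)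
    have "{0, 1} \<in> edges (book p)" "{0, 2} \<in> edges (book p)" "{1, 2} \<in> edges (book p)"
      using assms(1) by (simp_all add: book_spine book_page_edge del: One_nat_def)
    then have "{f 0, f 1} \<in> E" "{f 0, f 2} \<in> E" "{f 1, f 2} \<in> E" using f by fastforce+
    then show False unfolding E by auto
  qed
  moreover have "\<not> contains_subgraph (complement G) (book q)"
  proof
    assume "contains_subgraph (complement G) (book q)"
    then obtain f where inj: "inj_on f {..<q + 2}" and fV: "f ` {..<q + 2} \<subseteq> {..<N}"
      and f: "\<And>e. e \<in> edges (book q) \<Longrightarrow> f ` e \<in> edges (complement G)"
      by (auto simp: contains_subgraph_def complement_def G_def book_def[THEN arg_cong, of fst])
    \<comment> \<open>Vertex 0 of the book is adjacent to all others, so the whole book lies on the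
      side of \<open>f 0\<close>.\<close>
    have side: "f i < q + 1 \<longleftrightarrow> f 0 < q + 1" if i: "i < q + 2" for i
    proof (cases "i = 0")
      case False
      then have "{0, i} \<in> edges (book q)" using i by (cases "i = 1") (auto simp: book_spine book_page_edge simp del: One_nat_def)
      then have "{f 0, f i} \<in> edges (complement G)" using f by fastforce
      then show ?thesis unfolding mem_edges_complement by (auto simp: G_def E)
    qed simp
    define S where "S = (if f 0 < q + 1 then {..<q + 1} else {q + 1..<N})"
    have "f ` {..<q + 2} \<subseteq> S"
    proof (rule image_subsetI)
      fix i assume "i \<in> {..<q + 2}"
      then have "f i < q + 1 \<longleftrightarrow> f 0 < q + 1" "f i < N" using side[of i] fV by auto
      then show "f i \<in> S" unfolding S_def by (cases "f 0 < q + 1") auto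
    qed
    then have "card {..<q + 2} \<le> card S"
      using inj by (intro card_inj_on_le) (auto simp: S_def)
    then show False using assms(2) by (auto simp: S_def split: if_splits)
  qed
  ultimately show ?thesis by (intro exI[of _ G]) (simp add: G_def)
qed

theorem theorem4:
  fixes \<epsilon> :: real
  assumes "0 < \<epsilon>" and "\<epsilon> < 1 / 6"
  shows "\<exists>q\<^sub>0 :: nat. \<forall>q p :: nat. q \<ge> q\<^sub>0 \<and> p \<ge> 1 \<and> real p \<le> (1 / 6 - \<epsilon>) * real q \<longrightarrow>
           ramsey_number (book p) (book q) = 2 * q + 3"
proof -
  obtain n0 where n0: "\<forall>(V :: nat set) E. card V \<ge> n0 \<longrightarrow> \<not> book_avoiding V E (1 / 12 - \<epsilon> / 2)"
    using no_large_book_avoiding[of "\<epsilon> / 2"] assms(1) by auto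
  show ?thesis
  proof (intro exI[of _ n0] allI impI, elim conjE)
    fix q p :: nat assume q: "n0 \<le> q" and p: "1 \<le> p" "real p \<le> (1 / 6 - \<epsilon>) * real q"
    show "ramsey_number (book p) (book q) = 2 * q + 3"
      unfolding ramsey_number_def
    proof (rule Least_equality)
      show "\<forall>G :: nat graph. simple_graph G \<and> card (verts G) = 2 * q + 3 \<longrightarrow>
        contains_subgraph G (book p) \<or> contains_subgraph (complement G) (book q)"
      proof (intro allI impI, elim conjE, rule ccontr)
        fix G :: "nat graph"
        assume G: "simple_graph G" "card (verts G) = 2 * q + 3"
          and no: "\<not> (contains_subgraph G (book p) \<or> contains_subgraph (complement G) (book q))"
        \<comment> \<open>Since q \<le> |V|/2 and 1/6 - \<epsilon> is positive, the bound on
          \<open>p\<close> becomes (1/12 - \<epsilon>/2) |V|.\<close>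
        have "(1 / 6 - \<epsilon>) * real q \<le> (1 / 6 - \<epsilon>) * (real (card (verts G)) / 2)"
          using assms G(2) by (intro mult_left_mono) auto
        then have "real p \<le> (1 / 12 - \<epsilon> / 2) * card (verts G)"
          using p(2) by (simp add: field_simps)
        then have "book_avoiding (verts G) (\<lambda>x y. {x, y} \<in> edges G) (1 / 12 - \<epsilon> / 2)"
          using G no assms by - (rule book_avoiding_if_no_books[OF G], auto)
        then show False using n0 q G(2) by auto
      qed
    next
      fix N assume N: "\<forall>G :: nat graph. simple_graph G \<and> card (verts G) = N \<longrightarrow>
        contains_subgraph G (book p) \<or> contains_subgraph (complement G) (book q)"
      show "2 * q + 3 \<le> N"
      proof (rule ccontr)
        assume "\<not> ?thesis"
        then have "N \<le> 2 * q + 2" by simp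
        then show False using complete_bipartite_no_books[OF p(1), of N q] N by blast
      qed
    qed
  qed
qed

end
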